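(* Let $G$ be a bridgeless graph. Then for every $p\in[1,2]$, $$\phi_{3,p}(G)\le 1+\min\{g_1(p),g_2(p)\},$$ where $g_1(p)=\frac54\cdot2^{1-1/p}$ and $g_2(p)=\bigl[(2^{-1/p}+3^{-1/p})^p+(2^{-1/p}-3^{-1/p})^p+\tfrac13\bigr]^{1/p}$.
   Context: All graphs are finite and may have multiple edges but no loops. For an orientation $D$ and vertex $v$, $E_D^+(v)$, $E_D^-(v)$ are the out- and in-edges. For $\Omega\subseteq\mathbb{R}^d$, a vector $\Omega$-flow of $G$ is $(D,f)$ with $f:E(G)\to\Omega$ and $\sum_{e\in E_D^+(v)}f(e)-\sum_{e\in E_D^-(v)}f(e)=\mathbf{0}$ at every vertex. $\|x\|_p$ is the usual $p$-norm. For integer $d\ge1$, real $r\ge2$, $p\in[1,\infty]$, an $(r,d,p)$-NZF of $G$ is a vector $(\mathbb{R}^d\setminus\{\mathbf{0}\})$-flow $(D,f)$ with $1\le\|f(e)\|_p\le r-1$ for all edges. For a bridgeless graph $G$, $\phi_{d,p}(G)$ is the infimum of real $r$ such that $G$ admits an $(r,d,p)$-NZF. *)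

theory Defs
  imports "HOL-Analysis.Analysis" "Graph_Theory.Digraph"
begin

text \<open>Edges are named objects, so that parallel edges are possible; each edge is mapped to its
  set of end vertices.\<close>

record ('v, 'e) mgraph =
  vertices :: "'v set"
  edges :: "'e set"
  ends :: "'e \<Rightarrow> 'v set"

locale loopless_multigraph =
  fixes G :: "('v, 'e) mgraph"
  assumes finite_vertices: "finite (vertices G)"
    and finite_edges: "finite (edges G)"
    and ends_subset: "e \<in> edges G \<Longrightarrow> ends G e \<subseteq> vertices G"
    and card_ends: "e \<in> edges G \<Longrightarrow> card (ends G e) = 2"

definition adjacency :: "('v, 'e) mgraph \<Rightarrow> 'v rel" where
  "adjacency G = {(u, v). \<exists>e \<in> edges G. ends G e = {u, v}}"

definition connection :: "('v, 'e) mgraph \<Rightarrow> 'v rel" where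
  "connection G = {(u, v). u \<in> vertices G \<and> v \<in> vertices G \<and> (u, v) \<in> (adjacency G)\<^sup>*}"

definition graph_components :: "('v, 'e) mgraph \<Rightarrow> 'v set set" where
  "graph_components G = vertices G // connection G"

definition delete_edge :: "('v, 'e) mgraph \<Rightarrow> 'e \<Rightarrow> ('v, 'e) mgraph" where
  "delete_edge G e = G\<lparr>edges := edges G - {e}\<rparr>"

definition bridge :: "('v, 'e) mgraph \<Rightarrow> 'e \<Rightarrow> bool" where
  "bridge G e \<longleftrightarrow> e \<in> edges G \<and> card (graph_components G) < card (graph_components (delete_edge G e))"

definition bridgeless :: "('v, 'e) mgraph \<Rightarrow> bool" where
  "bridgeless G \<longleftrightarrow> (\<forall>e. \<not> bridge G e)"

definition orientation :: "('v, 'e) mgraph \<Rightarrow> ('v, 'e) pre_digraph \<Rightarrow> bool" where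
  "orientation G D \<longleftrightarrow> verts D = vertices G \<and> arcs D = edges G \<and>
     (\<forall>e \<in> edges G. {tail D e, head D e} = ends G e)"

text \<open>The space \<open>\<real>\<^sup>d\<close> is \<^typ>\<open>real ^ 'd\<close> with \<open>d = CARD('d)\<close>; the dimension is passed to
  functions whose other arguments do not mention it as an argument of type \<^typ>\<open>'d itself\<close>.\<close>

definition vector_flow ::
  "(real ^ 'd::finite) set \<Rightarrow> ('v, 'e) mgraph \<Rightarrow> ('v, 'e) pre_digraph \<Rightarrow> ('e \<Rightarrow> real ^ 'd) \<Rightarrow> bool" where
  "vector_flow \<Omega> G D f \<longleftrightarrow> orientation G D \<and> f \<in> edges G \<rightarrow> \<Omega> \<and>
     (\<forall>v \<in> vertices G. (\<Sum>e \<in> out_arcs D v. f e) - (\<Sum>e \<in> in_arcs D v. f e) = 0)"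

definition p_norm :: "ereal \<Rightarrow> real ^ 'd::finite \<Rightarrow> real" where
  "p_norm p x =
     (if p = \<infinity> then infnorm x
      else (\<Sum>i \<in> UNIV. \<bar>x $ i\<bar> powr real_of_ereal p) powr (1 / real_of_ereal p))"

text \<open>The standing assumptions \<open>r \<ge> 2\<close> and \<open>p \<in> [1, \<infinity>]\<close> are part of the notion.\<close>

definition is_NZF ::
  "real \<Rightarrow> ereal \<Rightarrow> ('v, 'e) mgraph \<Rightarrow> ('v, 'e) pre_digraph \<Rightarrow> ('e \<Rightarrow> real ^ 'd::finite) \<Rightarrow> bool" where
  "is_NZF r p G D f \<longleftrightarrow> 2 \<le> r \<and> 1 \<le> p \<and> vector_flow (UNIV - {0}) G D f \<and>
     (\<forall>e \<in> edges G. 1 \<le> p_norm p (f e) \<and> p_norm p (f e) \<le> r - 1)"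

text \<open>The infimum is taken in the extended reals, so that it is \<open>\<infinity>\<close> when no flow exists; an upper
  bound on it by a real number thus entails the existence of a flow.\<close>

definition flow_index :: "'d::finite itself \<Rightarrow> ereal \<Rightarrow> ('v, 'e) mgraph \<Rightarrow> ereal" where
  "flow_index d p G = Inf {ereal r | r. \<exists>D (f :: 'e \<Rightarrow> real ^ 'd). is_NZF r p G D f}"

definition g1 :: "real \<Rightarrow> real" where
  "g1 p = 5 / 4 * 2 powr (1 - 1 / p)"

definition g2 :: "real \<Rightarrow> real" where
  "g2 p = ((2 powr (- 1 / p) + 3 powr (- 1 / p)) powr p +
           (2 powr (- 1 / p) - 3 powr (- 1 / p)) powr p + 1 / 3) powr (1 / p)"

end

theory Submission
  imports Defs
begin

text \<open>By Seymour's 6-flow theorem the edges of a bridgeless graph are covered by an even subgraph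
  and the support of a flow modulo 3. Lifting both to the integers gives a flow \<open>c\<close> with values in
  \<open>{0, 1, -1}\<close> and a flow with values of modulus at most 2, which splits into two flows \<open>a\<close>, \<open>b\<close> such that
  at each edge \<open>(a, b)\<close> is \<open>0\<close> or one of \<open>(1, 0)\<close>, \<open>(0, 1)\<close>, \<open>(1, 1)\<close> up to sign. For vectors
  \<open>u\<close>, \<open>w\<close>, \<open>z\<close> the flow \<open>a u + b w + c z\<close> then takes, up to sign, only the values \<open>x\<close>, \<open>z\<close> and \<open>z \<plusminus> x\<close>
  with \<open>x\<close> among \<open>u\<close>, \<open>w\<close>, \<open>u + w\<close>. The bound \<open>g2\<close> comes from a multiple of \<open>(1, 1, 1)\<close> for \<open>z\<close> and
  scaled roots of type \<open>A\<^sub>2\<close> for \<open>u\<close>, \<open>w\<close>; the bound \<open>g1\<close> comes from multiples of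
  \<open>z = (3, 3, 2)\<close>, \<open>u = (1, -3, 4)\<close>, \<open>w = (-4, 4, 0)\<close>, for which the ten norms lie between
  8 and 10 when \<open>p = 1\<close>.\<close>

section \<open>Integer flows in oriented graphs\<close>

text \<open>Each condition excludes a single residue of \<open>c\<close> modulo 3, because
  \<open>p\<close> and \<open>q\<close> are invertible there, so one of the three residues
  survives.\<close>

lemma avoid_zero_mod_3:
  fixes a b p q :: int
  assumes "\<not> 3 dvd p" "\<not> 3 dvd q"
  obtains c where "\<not> 3 dvd a + c * p" "\<not> 3 dvd b + c * q"
proof -
  have "(\<not> 3 dvd a + 0 * p \<and> \<not> 3 dvd b + 0 * q) \<or> (\<not> 3 dvd a + 1 * p \<and> \<not> 3 dvd b + 1 * q)
    \<or> (\<not> 3 dvd a + 2 * p \<and> \<not> 3 dvd b + 2 * q)"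
    using assms by presburger
  then show ?thesis using that by blast
qed

locale oriented_graph =
  fixes V :: "'v set" and E :: "'e set" and t h :: "'e \<Rightarrow> 'v"
  assumes finV: "finite V" and finE: "finite E"
    and tV: "e \<in> E \<Longrightarrow> t e \<in> V" and hV: "e \<in> E \<Longrightarrow> h e \<in> V"
    and t_neq_h: "e \<in> E \<Longrightarrow> t e \<noteq> h e"
begin

text \<open>With a vertex set as argument, incidence is additive over vertices: contributions of
  edges inside \<open>S\<close> cancel and only the boundary of \<open>S\<close> counts.\<close>

definition inc :: "'e \<Rightarrow> 'v set \<Rightarrow> int" where
  "inc e S = of_bool (t e \<in> S) - of_bool (h e \<in> S)"

definition net :: "('e \<Rightarrow> int) \<Rightarrow> 'v \<Rightarrow> int" where
  "net f v = (\<Sum>e\<in>E. f e * inc e {v})"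

definition cut :: "'v set \<Rightarrow> 'e set" where
  "cut S = {e \<in> E. (t e \<in> S) \<noteq> (h e \<in> S)}"

definition inside :: "'v set \<Rightarrow> 'e set" where
  "inside S = {e \<in> E. t e \<in> S \<and> h e \<in> S}"

text \<open>Signs vanish modulo 2, so the parity of \<open>net\<close> is the parity of the degree,
  and the lemmas on flows apply directly.\<close>

definition even_edges :: "'e set \<Rightarrow> bool" where
  "even_edges B \<longleftrightarrow> B \<subseteq> E \<and> (\<forall>v\<in>V. even (net (\<lambda>e. of_bool (e \<in> B)) v))"

text \<open>Connectedness by edges of \<open>A\<close>, expressed by a unit flow from \<open>x\<close> to \<open>y\<close> rather than a path.\<close>

definition linked :: "'e set \<Rightarrow> 'v \<Rightarrow> 'v \<Rightarrow> bool" where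
  "linked A x y \<longleftrightarrow> (\<exists>g. (\<forall>e\<in>E - A. g e = 0) \<and> (\<forall>v\<in>V. net g v = of_bool (v = x) - of_bool (v = y)))"

section \<open>Linearity of the net outflow and its sums over vertex sets\<close>

lemma net_add: "net (\<lambda>e. f e + g e) v = net f v + net g v"
  by (simp add: net_def algebra_simps sum.distrib)

lemma net_diff: "net (\<lambda>e. f e - g e) v = net f v - net g v"
  by (simp add: net_def algebra_simps sum_subtractf)

lemma net_cmult: "net (\<lambda>e. c * f e) v = c * net f v"
  by (simp add: net_def sum_distrib_left algebra_simps)

lemma net_sum: "net (\<lambda>e. \<Sum>i\<in>I. f i e) v = (\<Sum>i\<in>I. net (f i) v)"
  unfolding net_def by (simp add: sum_distrib_right sum.swap[of _ E I])

lemma net_single: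
  assumes "e \<in> E"
  shows "net (\<lambda>e'. c * of_bool (e' = e)) v = c * (of_bool (v = t e) - of_bool (v = h e))"
proof -
  have "net (\<lambda>e'. c * of_bool (e' = e)) v = (\<Sum>e'\<in>E. if e' = e then c * inc e {v} else 0)"
    unfolding net_def by (rule sum.cong) auto
  also have "\<dots> = c * inc e {v}"
    using assms finE by simp
  finally show ?thesis by (auto simp: inc_def)
qed

lemma net_cong: "(\<And>e. e \<in> E \<Longrightarrow> f e = g e) \<Longrightarrow> net f v = net g v"
  by (simp add: net_def)

lemma sum_net:
  assumes "finite S"
  shows "(\<Sum>v\<in>S. net f v) = (\<Sum>e\<in>E. f e * inc e S)"
proof -
  have inc_sum: "(\<Sum>v\<in>S. inc e {v}) = inc e S" for e
    using assms by (simp add: inc_def sum_subtractf of_bool_def)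
  show ?thesis
    unfolding net_def by (subst sum.swap) (simp add: sum_distrib_left[symmetric] inc_sum)
qed

lemma sum_net_V: "(\<Sum>v\<in>V. net f v) = 0"
  by (simp add: sum_net[OF finV] inc_def tV hV)

lemma inc_not_cut: "e \<in> E \<Longrightarrow> e \<notin> cut S \<Longrightarrow> inc e S = 0"
  by (auto simp: inc_def cut_def)

lemma sum_net_cut:
  assumes "finite S"
  shows "(\<Sum>v\<in>S. net f v) = (\<Sum>e\<in>cut S. f e * inc e S)"
  unfolding sum_net[OF assms]
  by (rule sum.mono_neutral_right) (use finE inc_not_cut in \<open>auto simp: cut_def\<close>)

section \<open>Feasible flows and lifting of modular flows\<close>

text \<open>Hoffman's feasibility theorem for integer flows. A flow within the bounds of least total
  defect is taken; if the defect were positive, either a surplus unit could be rerouted to a vertex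
  in deficit or a tight cut would violate the hypothesis.\<close>

lemma feasible_flow:
  fixes l u :: "'e \<Rightarrow> int" and b :: "'v \<Rightarrow> int"
  assumes lu: "\<And>e. e \<in> E \<Longrightarrow> l e \<le> u e"
    and b0: "(\<Sum>v\<in>V. b v) = 0"
    and cut: "\<And>S. S \<subseteq> V \<Longrightarrow> (\<Sum>v\<in>S. b v) \<le>
      (\<Sum>e\<in>E. if t e \<in> S \<and> h e \<notin> S then u e else if h e \<in> S \<and> t e \<notin> S then - l e else 0)"
  obtains f where "\<And>e. e \<in> E \<Longrightarrow> l e \<le> f e \<and> f e \<le> u e" "\<And>v. v \<in> V \<Longrightarrow> net f v = b v"
proof -
  define ok where "ok f \<longleftrightarrow> (\<forall>e\<in>E. l e \<le> f e \<and> f e \<le> u e)" for f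
  define def where "def f = nat (\<Sum>v\<in>V. \<bar>net f v - b v\<bar>)" for f
  have "ok l" using lu by (simp add: ok_def)
  then obtain f where f: "ok f" and fmin: "\<And>g. ok g \<Longrightarrow> def f \<le> def g"
    using ex_has_least_nat[of ok l def] by blast
  have "net f v = b v" if "v \<in> V" for v
  proof (rule ccontr)
    assume nv: "net f v \<noteq> b v"
    have "\<exists>w\<in>V. net f w > b w"
    proof (rule ccontr)
      assume "\<not> ?thesis"
      then have "\<forall>v\<in>V. b v - net f v \<ge> 0" by auto
      moreover have "(\<Sum>v\<in>V. b v - net f v) = 0"
        by (simp add: sum_subtractf sum_net_V b0)
      ultimately have "\<forall>v\<in>V. b v - net f v = 0"
        using sum_nonneg_eq_0_iff[OF finV, of "\<lambda>v. b v - net f v"] by simp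
      with nv that show False by simp
    qed
    then obtain w where w: "w \<in> V" "net f w > b w" by blast
    \<comment> \<open>This replaces augmenting paths: every vertex of a \<open>good\<close> set can
      take over one unit of the surplus at \<open>w\<close> by changes confined to edges inside the
      set.\<close>
    define good where "good W \<longleftrightarrow> w \<in> W \<and> W \<subseteq> V \<and> (\<forall>v\<in>W. \<exists>f'. ok f' \<and>
        (\<forall>e\<in>E - inside W. f' e = f e) \<and>
        (\<forall>x\<in>V. net f' x = net f x + of_bool (x = v) - of_bool (x = w)))" for W
    have "good {w}" using w f by (auto simp: good_def intro!: exI[of _ f])
    moreover have "finite {W. good W}"
      by (rule finite_subset[of _ "Pow V"]) (auto simp: good_def finV)
    ultimately obtain W where W: "good W" and Wmax: "\<And>W'. good W' \<Longrightarrow> W \<subseteq> W' \<Longrightarrow> W' = W"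
      using finite_has_maximal[of "{W. good W}"] by blast
    have WV: "W \<subseteq> V" and wW: "w \<in> W" using W by (auto simp: good_def)
    have finW: "finite W" using WV finV finite_subset by blast
    text \<open>An edge with room for one more unit that leads from outside into \<open>W\<close> would enlarge \<open>W\<close>;
      changing it does not interfere with the rerouting inside \<open>W\<close>.\<close>
    have extend: False
      if v: "v \<in> V" "v \<notin> W" and x: "x \<in> W" and e: "e \<in> E"
        and ends: "{t e, h e} = {v, x}"
        and d: "\<And>y. y \<in> V \<Longrightarrow> d * (of_bool (y = t e) - of_bool (y = h e)) = of_bool (y = v) - of_bool (y = x)"
        and bnd: "l e \<le> f e + d" "f e + d \<le> u e" for v x e d
    proof -
      have en: "e \<notin> inside W" using ends v by (auto simp: inside_def doubleton_eq_iff)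
      have ei: "e \<in> inside (insert v W)" using e ends x by (auto simp: inside_def doubleton_eq_iff)
      obtain f' where f': "ok f'" "\<forall>e\<in>E - inside W. f' e = f e"
        "\<forall>y\<in>V. net f' y = net f y + of_bool (y = x) - of_bool (y = w)"
        using W x unfolding good_def by blast
      define f'' where "f'' e' = f' e' + d * of_bool (e' = e)" for e'
      have "ok f''"
        unfolding ok_def
      proof
        fix e' assume e': "e' \<in> E"
        show "l e' \<le> f'' e' \<and> f'' e' \<le> u e'"
          using f' e e' en bnd by (cases "e' = e") (auto simp: f''_def ok_def)
      qed
      moreover have "\<forall>e\<in>E - inside (insert v W). f'' e = f e"
        using f'(2) ei by (auto simp: f''_def inside_def)
      moreover have "\<forall>y\<in>V. net f'' y = net f y + of_bool (y = v) - of_bool (y = w)"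
        unfolding f''_def using f'(3) d by (simp add: net_add net_single[OF e])
      ultimately have new: "\<exists>f'. ok f' \<and> (\<forall>e\<in>E - inside (insert v W). f' e = f e) \<and>
        (\<forall>y\<in>V. net f' y = net f y + of_bool (y = v) - of_bool (y = w))" by blast
      have sub: "inside W \<subseteq> inside (insert v W)" by (auto simp: inside_def)
      have "good (insert v W)"
        unfolding good_def
      proof (intro conjI ballI)
        fix z assume z: "z \<in> insert v W"
        show "\<exists>f'. ok f' \<and> (\<forall>e\<in>E - inside (insert v W). f' e = f e) \<and>
          (\<forall>y\<in>V. net f' y = net f y + of_bool (y = z) - of_bool (y = w))"
        proof (cases "z = v")
          case True then show ?thesis using new by simp
        next
          case False
          then have "z \<in> W" using z by simp
          then obtain f' where "ok f'" "\<forall>e\<in>E - inside W. f' e = f e"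
            "\<forall>y\<in>V. net f' y = net f y + of_bool (y = z) - of_bool (y = w)"
            using W unfolding good_def by blast
          then show ?thesis using sub by blast
        qed
      qed (use W v in \<open>auto simp: good_def\<close>)
      then show False using Wmax[of "insert v W"] v by blast
    qed
    \<comment> \<open>By maximality of \<open>W\<close> all edges across its boundary are tight:
      entering edges are at their upper bound, leaving edges at their lower bound.\<close>
    have out: "f e = u e" if "e \<in> E" "t e \<notin> W" "h e \<in> W" for e
    proof (rule ccontr)
      assume "f e \<noteq> u e"
      then have "f e < u e" "l e \<le> f e" using f that by (auto simp: ok_def less_le)
      then show False
        using extend[of "t e" "h e" e 1] that tV by auto
    qed
    have into: "f e = l e" if "e \<in> E" "t e \<in> W" "h e \<notin> W" for e
    proof (rule ccontr)
      assume "f e \<noteq> l e"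
      then have "f e > l e" "f e \<le> u e" using f that by (auto simp: ok_def less_le)
      then show False
        using extend[of "h e" "t e" e "-1"] that hV by auto
    qed
    \<comment> \<open>The cut condition is used for the complement of \<open>W\<close>. As the
      boundary is tight, its right-hand side is the actual net outflow of \<open>f\<close> from
      \<open>V - W\<close>.\<close>
    have "(\<Sum>v\<in>V - W. b v) \<le>
      (\<Sum>e\<in>E. if t e \<in> V - W \<and> h e \<notin> V - W then u e else if h e \<in> V - W \<and> t e \<notin> V - W then - l e else 0)"
      by (rule cut) auto
    also have "\<dots> = (\<Sum>e\<in>E. - (f e * inc e W))"
      by (rule sum.cong) (use out into tV hV in \<open>auto simp: inc_def\<close>)
    also have "\<dots> = - (\<Sum>v\<in>W. net f v)"
      by (simp add: sum_net[OF finW] sum_negf)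
    finally have "(\<Sum>v\<in>W. net f v) \<le> - (\<Sum>v\<in>V - W. b v)" by simp
    moreover have "(\<Sum>v\<in>V - W. b v) = - (\<Sum>v\<in>W. b v)"
      using b0 sum.subset_diff[OF WV finV, of b] by simp
    ultimately have le: "(\<Sum>v\<in>W. net f v) \<le> (\<Sum>v\<in>W. b v)" by simp
    have "\<exists>v\<in>W. net f v < b v"
    proof (rule ccontr)
      assume "\<not> ?thesis"
      then have "(\<Sum>v\<in>W. b v) < (\<Sum>v\<in>W. net f v)"
        using w wW finW by (intro sum_strict_mono_ex1) auto
      with le show False by simp
    qed
    then obtain v where v: "v \<in> W" "net f v < b v" by blast
    then obtain f' where f': "ok f'"
        "\<forall>y\<in>V. net f' y = net f y + of_bool (y = v) - of_bool (y = w)"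
      using W unfolding good_def by blast
    have vV: "v \<in> V" using v WV by blast
    \<comment> \<open>One unit moves from the surplus at \<open>w\<close> to the deficit at
      \<open>v\<close>, which contradicts the minimal defect of \<open>f\<close>.\<close>
    have "(\<Sum>x\<in>V. \<bar>net f' x - b x\<bar>) < (\<Sum>x\<in>V. \<bar>net f x - b x\<bar>)"
    proof (rule sum_strict_mono_ex1[OF finV])
      show "\<forall>x\<in>V. \<bar>net f' x - b x\<bar> \<le> \<bar>net f x - b x\<bar>"
        using f'(2) v w by auto
      show "\<exists>x\<in>V. \<bar>net f' x - b x\<bar> < \<bar>net f x - b x\<bar>"
        using f'(2) v w vV by (intro bexI[of _ v]) auto
    qed
    moreover have "0 \<le> (\<Sum>x\<in>V. \<bar>net f' x - b x\<bar>)" by (simp add: sum_nonneg)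
    ultimately have "def f' < def f" unfolding def_def by linarith
    then show False using fmin[OF f'(1)] by simp
  qed
  then show ?thesis using that f by (auto simp: ok_def)
qed

text \<open>Tutte's passage from flows modulo \<open>k\<close> to integer flows: residues are taken
  in \<open>0..k-1\<close>, and \<open>k\<close> is subtracted on the edges selected by a 0-1 flow
  \<open>y\<close> that absorbs the excess \<open>b\<close>.\<close>

lemma modular_lift:
  fixes k :: int
  assumes k: "k > 0" and f: "\<And>v. v \<in> V \<Longrightarrow> k dvd net f v"
  obtains g where "\<And>e. e \<in> E \<Longrightarrow> \<bar>g e\<bar> < k \<and> k dvd g e - f e" "\<And>v. v \<in> V \<Longrightarrow> net g v = 0"
proof -
  define f0 where "f0 e = f e mod k" for e
  have f0: "0 \<le> f0 e" "f0 e < k" "k dvd f0 e - f e" for e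
    using k by (auto simp: f0_def mod_eq_dvd_iff[symmetric])
  \<comment> \<open>Edges of residue 0 get capacity 0, since subtracting \<open>k\<close> there
    would break the strict bound.\<close>
  define u :: "'e \<Rightarrow> int" where "u e = of_bool (f0 e \<noteq> 0)" for e
  have f0u: "f0 e \<le> k * u e" for e using f0(2)[of e] by (auto simp: u_def)
  define b where "b v = net f0 v div k" for v
  have kb: "k * b v = net f0 v" if "v \<in> V" for v
  proof -
    have "k dvd net (\<lambda>e. f0 e - f e) v"
      unfolding net_def by (intro dvd_sum dvd_mult2 f0)
    then have "k dvd net f0 v"
      using dvd_add[of k "net f0 v - net f v" "net f v"] f[OF that] by (simp add: net_diff)
    then show ?thesis by (simp add: b_def)
  qed
  have kbS: "k * (\<Sum>v\<in>S. b v) = (\<Sum>e\<in>E. f0 e * inc e S)" if "S \<subseteq> V" for S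
  proof -
    have "k * (\<Sum>v\<in>S. b v) = (\<Sum>v\<in>S. net f0 v)"
      unfolding sum_distrib_left by (rule sum.cong) (use kb that in auto)
    then show ?thesis using sum_net[of S f0] finite_subset[OF that finV] by simp
  qed
  obtain y where y: "\<And>e. e \<in> E \<Longrightarrow> 0 \<le> y e \<and> y e \<le> u e" "\<And>v. v \<in> V \<Longrightarrow> net y v = b v"
  proof (rule feasible_flow[of "\<lambda>_. 0" u b])
    show "(\<Sum>v\<in>V. b v) = 0"
      using kbS[of V] k by (simp add: inc_def tV hV)
    fix S assume "S \<subseteq> V"
    \<comment> \<open>The fractional flow \<open>f0 / k\<close> respects the bounds and has net
      outflow \<open>b\<close>, whence the cut condition; it is multiplied by \<open>k\<close> to
      stay in the integers.\<close>
    have "k * (\<Sum>v\<in>S. b v) \<le> (\<Sum>e\<in>E. k * (if t e \<in> S \<and> h e \<notin> S then u e else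
      if h e \<in> S \<and> t e \<notin> S then - 0 else 0))"
      unfolding kbS[OF \<open>S \<subseteq> V\<close>]
      by (rule sum_mono) (use f0 f0u in \<open>auto simp: inc_def\<close>)
    then show "(\<Sum>v\<in>S. b v) \<le> (\<Sum>e\<in>E. if t e \<in> S \<and> h e \<notin> S then u e else
      if h e \<in> S \<and> t e \<notin> S then - 0 else 0)"
      using k by (simp add: sum_distrib_left[symmetric])
  qed (auto simp: u_def)
  show ?thesis
  proof (rule that[of "\<lambda>e. f0 e - k * y e"])
    fix e assume "e \<in> E"
    have "\<bar>f0 e - k * y e\<bar> < k"
    proof (cases "f0 e = 0")
      case False
      then have "y e = 0 \<or> y e = 1" using y(1)[OF \<open>e \<in> E\<close>] by (auto simp: u_def)
      then show ?thesis using False f0(1,2)[of e] by auto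
    qed (use y(1)[OF \<open>e \<in> E\<close>] k in \<open>auto simp: u_def\<close>)
    moreover have "k dvd (f0 e - f e) - k * y e" by (intro dvd_diff f0) simp
    ultimately show "\<bar>f0 e - k * y e\<bar> < k \<and> k dvd f0 e - k * y e - f e"
      by (simp add: algebra_simps)
  qed (simp add: net_diff net_cmult y(2) kb)
qed

text \<open>Menger's theorem for two edge-disjoint paths, as a flow of value 2. The bounds -1 and 1
  on \<open>D\<close> let each edge be used in either direction.\<close>

lemma double_path:
  assumes xy: "x \<in> V" "y \<in> V" "x \<noteq> y"
    and cut2: "\<And>S. S \<subseteq> V \<Longrightarrow> x \<in> S \<Longrightarrow> y \<notin> S \<Longrightarrow> card (D \<inter> cut S) \<ge> 2"
  obtains f where "\<And>e. e \<in> E \<Longrightarrow> \<bar>f e\<bar> \<le> of_bool (e \<in> D)"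
    "\<And>v. v \<in> V \<Longrightarrow> net f v = 2 * (of_bool (v = x) - of_bool (v = y))"
proof -
  let ?b = "\<lambda>v. 2 * (of_bool (v = x) - of_bool (v = y)) :: int"
  have sb: "(\<Sum>v\<in>S. ?b v) = 2 * (of_bool (x \<in> S) - of_bool (y \<in> S))" if "S \<subseteq> V" for S
    unfolding sum_distrib_left[symmetric]
    using finite_subset[OF that finV] by (simp add: sum_subtractf of_bool_def)
  obtain f where "\<And>e. e \<in> E \<Longrightarrow> - of_bool (e \<in> D) \<le> f e \<and> f e \<le> of_bool (e \<in> D)"
    "\<And>v. v \<in> V \<Longrightarrow> net f v = ?b v"
  proof (rule feasible_flow[of "\<lambda>e. - of_bool (e \<in> D)" "\<lambda>e. of_bool (e \<in> D)" ?b])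
    show "(\<Sum>v\<in>V. ?b v) = 0" using sb[of V] xy by simp
    fix S assume S: "S \<subseteq> V"
    have "(\<Sum>e\<in>E. if t e \<in> S \<and> h e \<notin> S then of_bool (e \<in> D) else
        if h e \<in> S \<and> t e \<notin> S then - (- of_bool (e \<in> D)) else 0)
      = (\<Sum>e\<in>E. if e \<in> D \<inter> cut S then 1 else (0::int))"
      by (rule sum.cong) (auto simp: cut_def)
    also have "\<dots> = int (card (D \<inter> cut S))"
    proof -
      have "E \<inter> (D \<inter> cut S) = D \<inter> cut S" by (auto simp: cut_def)
      then show ?thesis
        using sum.inter_restrict[OF finE, of "\<lambda>_. 1::int" "D \<inter> cut S"] by simp
    qed
    finally show "(\<Sum>v\<in>S. ?b v) \<le> (\<Sum>e\<in>E. if t e \<in> S \<and> h e \<notin> S then of_bool (e \<in> D) else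
        if h e \<in> S \<and> t e \<notin> S then - (- of_bool (e \<in> D)) else 0)"
      unfolding sb[OF S] using cut2[OF S] by (auto simp: of_bool_def)
  qed auto
  then show ?thesis using that by (metis abs_le_iff minus_le_iff)
qed

section \<open>Linking, cuts and components\<close>

lemma linked_refl: "linked A x x"
  unfolding linked_def by (rule exI[of _ "\<lambda>_. 0"]) (simp add: net_def)

lemma linked_sym:
  assumes "linked A x y"
  shows "linked A y x"
proof -
  obtain g where "\<forall>e\<in>E - A. g e = 0" "\<forall>v\<in>V. net g v = of_bool (v = x) - of_bool (v = y)"
    using assms unfolding linked_def by blast
  then show ?thesis
    unfolding linked_def using net_cmult[of "-1" g] by (intro exI[of _ "\<lambda>e. -1 * g e"]) simp
qed

lemma linked_trans:
  assumes "linked A x y" "linked A y z"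
  shows "linked A x z"
proof -
  obtain g g' where "\<forall>e\<in>E - A. g e = 0" "\<forall>v\<in>V. net g v = of_bool (v = x) - of_bool (v = y)"
    and "\<forall>e\<in>E - A. g' e = 0" "\<forall>v\<in>V. net g' v = of_bool (v = y) - of_bool (v = z)"
    using assms unfolding linked_def by blast
  then show ?thesis
    unfolding linked_def by (intro exI[of _ "\<lambda>e. g e + g' e"]) (simp add: net_add)
qed

lemma linked_mono: "linked A x y \<Longrightarrow> A \<subseteq> A' \<Longrightarrow> linked A' x y"
  unfolding linked_def by blast

lemma linked_edge:
  assumes "e \<in> E" "e \<in> A" "{t e, h e} = {x, y}"
  shows "linked A x y"
proof -
  have "linked A (t e) (h e)"
    unfolding linked_def using assms net_single[OF assms(1), of 1]
    by (intro exI[of _ "\<lambda>e'. 1 * of_bool (e' = e)"]) auto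
  then show ?thesis using assms(3) linked_sym by (auto simp: doubleton_eq_iff)
qed

lemma cut_subset: "cut S \<subseteq> E"
  by (auto simp: cut_def)

lemma finite_cut: "finite (cut S)"
  using finE cut_subset finite_subset by blast

text \<open>A unit flow from \<open>x\<close> to \<open>y\<close> has net outflow 1 from
  \<open>S\<close>, so it cannot vanish on the whole boundary.\<close>

lemma linked_cut:
  assumes "linked A x y" "S \<subseteq> V" "x \<in> S" "y \<notin> S"
  shows "A \<inter> cut S \<noteq> {}"
proof
  assume em: "A \<inter> cut S = {}"
  obtain g where g: "\<forall>e\<in>E - A. g e = 0" "\<forall>v\<in>V. net g v = of_bool (v = x) - of_bool (v = y)"
    using assms unfolding linked_def by blast
  have finS: "finite S" using assms(2) finV finite_subset by blast
  have "(\<Sum>v\<in>S. net g v) = (\<Sum>v\<in>S. of_bool (v = x) - of_bool (v = y))"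
    using g(2) assms(2) by (intro sum.cong) auto
  also have "\<dots> = 1"
    using finS assms by (simp add: sum_subtractf of_bool_def)
  finally have "(\<Sum>e\<in>cut S. g e * inc e S) = 1"
    by (simp add: sum_net_cut[OF finS])
  moreover have "(\<Sum>e\<in>cut S. g e * inc e S) = 0"
    by (rule sum.neutral) (use g(1) em cut_subset in auto)
  ultimately show False by simp
qed

lemma component_cut:
  "A \<inter> cut {y \<in> V. linked A x y} = {}"
proof (rule ccontr)
  assume "\<not> ?thesis"
  then obtain e where e: "e \<in> A" "e \<in> cut {y \<in> V. linked A x y}" by blast
  then have "e \<in> E" by (simp add: cut_def)
  with e(1) have "linked A (t e) (h e)" "linked A (h e) (t e)"
    by (auto intro: linked_edge)
  with e(2) tV hV show False
    by (auto simp: cut_def dest: linked_trans)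
qed

text \<open>If the support avoids the boundary of \<open>S\<close>, the function splits into a part
  inside \<open>S\<close> and a part outside that do not share vertices.\<close>

lemma net_restrict:
  assumes "A \<inter> cut S = {}" "\<forall>e\<in>E - A. f e = 0"
  shows "net (\<lambda>e. of_bool (e \<in> inside S) * f e) v = of_bool (v \<in> S) * net f v"
  unfolding net_def sum_distrib_left
proof (rule sum.cong)
  fix e assume e: "e \<in> E"
  show "of_bool (e \<in> inside S) * f e * inc e {v} = of_bool (v \<in> S) * (f e * inc e {v})"
  proof (cases "e \<in> A")
    case True
    then have "(t e \<in> S) = (h e \<in> S)" using assms(1) e by (auto simp: cut_def)
    then show ?thesis using e by (auto simp: inside_def inc_def)
  qed (use assms(2) e in auto)
qed simp

lemma linked_restrict:
  assumes "linked A x y" "A \<inter> cut S = {}" "x \<in> S" "y \<in> S"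
  shows "linked (A \<inter> inside S) x y"
proof -
  obtain g where g: "\<forall>e\<in>E - A. g e = 0" "\<forall>v\<in>V. net g v = of_bool (v = x) - of_bool (v = y)"
    using assms unfolding linked_def by blast
  show ?thesis
    unfolding linked_def
    by (intro exI[of _ "\<lambda>e. of_bool (e \<in> inside S) * g e"])
      (use g assms in \<open>auto simp: net_restrict[OF assms(2) g(1)]\<close>)
qed

section \<open>Even subgraphs\<close>

text \<open>Functions that agree modulo 2 on edges have net outflows of equal parity, so the odd
  edges of \<open>f\<close> form an even subgraph.\<close>

lemma even_edges_cong:
  assumes "B \<subseteq> E" "\<And>v. v \<in> V \<Longrightarrow> even (net f v)" "\<And>e. e \<in> E \<Longrightarrow> even (f e) \<longleftrightarrow> e \<notin> B"
  shows "even_edges B"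
  unfolding even_edges_def
proof (intro conjI ballI)
  fix v assume "v \<in> V"
  have "even (net (\<lambda>e. of_bool (e \<in> B) - f e) v)"
    unfolding net_def by (intro dvd_sum dvd_mult2) (use assms(3) in auto)
  then show "even (net (\<lambda>e. of_bool (e \<in> B)) v)"
    using assms(2)[OF \<open>v \<in> V\<close>] by (simp add: net_diff)
qed (rule assms)

text \<open>Two edge-disjoint paths from \<open>x\<close> to \<open>y\<close> form an even subgraph.
  They come as the support of a flow of value 2, which may also contain stray circuits; keeping only
  the component of \<open>x\<close> makes the result connected.\<close>

lemma connected_even_edges:
  assumes X: "X \<subseteq> V" and x: "x \<in> X" and y: "y \<in> X"
    and cut2: "\<And>Y. Y \<subseteq> X \<Longrightarrow> x \<in> Y \<Longrightarrow> y \<notin> Y \<Longrightarrow> card (inside X \<inter> cut Y) \<ge> 2"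
  obtains W H where "W \<subseteq> X" "x \<in> W" "y \<in> W" "H \<subseteq> inside W" "even_edges H"
    "\<And>z. z \<in> W \<Longrightarrow> linked H x z"
proof (cases "x = y")
  case True
  show ?thesis
    by (rule that[of "{x}" "{}"]) (use True x in \<open>auto simp: even_edges_def net_def linked_refl\<close>)
next
  case False
  have "card (inside X \<inter> cut S) \<ge> 2" if "S \<subseteq> V" "x \<in> S" "y \<notin> S" for S
  proof -
    have "inside X \<inter> cut S = inside X \<inter> cut (S \<inter> X)" by (auto simp: inside_def cut_def)
    then show ?thesis using cut2[of "S \<inter> X"] that x by auto
  qed
  then obtain f where f: "\<And>e. e \<in> E \<Longrightarrow> \<bar>f e\<bar> \<le> of_bool (e \<in> inside X)"
    "\<And>v. v \<in> V \<Longrightarrow> net f v = 2 * (of_bool (v = x) - of_bool (v = y))"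
    using double_path[of x y "inside X"] X x y False by blast
  define A where "A = {e \<in> E. f e \<noteq> 0}"
  have AX: "A \<subseteq> inside X"
  proof
    fix e assume "e \<in> A"
    then show "e \<in> inside X" using f(1)[of e] by (cases "e \<in> inside X") (auto simp: A_def)
  qed
  have fA: "\<forall>e\<in>E - A. f e = 0" by (simp add: A_def)
  define W where "W = {z \<in> V. linked A x z}"
  have cutW: "A \<inter> cut W = {}" unfolding W_def by (rule component_cut)
  have xW: "x \<in> W" using x X by (auto simp: W_def linked_refl)
  have WV: "W \<subseteq> V" by (auto simp: W_def)
  have finW: "finite W" using WV finV finite_subset by blast
  have "W \<subseteq> X"
  proof
    fix z assume z: "z \<in> W"
    show "z \<in> X"
    proof (rule ccontr)
      assume "z \<notin> X"
      then have "A \<inter> cut X \<noteq> {}" using linked_cut[OF _ X x] z by (auto simp: W_def)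
      then show False using AX by (auto simp: inside_def cut_def)
    qed
  qed
  \<comment> \<open>Otherwise the two units starting at \<open>x\<close> would have to leave
    \<open>W\<close>, but no edge of the support does.\<close>
  moreover have "y \<in> W"
  proof (rule ccontr)
    assume "y \<notin> W"
    have "(\<Sum>v\<in>W. net f v) = (\<Sum>v\<in>W. 2 * (of_bool (v = x) - of_bool (v = y)))"
      using f(2) WV by (intro sum.cong) auto
    also have "\<dots> = 2"
      unfolding sum_distrib_left[symmetric]
      using finW \<open>y \<notin> W\<close> xW by (simp add: sum_subtractf of_bool_def)
    finally have "(\<Sum>e\<in>cut W. f e * inc e W) = 2" by (simp add: sum_net_cut[OF finW])
    moreover have "(\<Sum>e\<in>cut W. f e * inc e W) = 0"
      by (rule sum.neutral) (use fA cutW cut_subset in auto)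
    ultimately show False by simp
  qed
  moreover have "even_edges (A \<inter> inside W)"
  proof (rule even_edges_cong[of _ "\<lambda>e. of_bool (e \<in> inside W) * f e"])
    show "A \<inter> inside W \<subseteq> E" by (auto simp: inside_def)
    show "even (net (\<lambda>e. of_bool (e \<in> inside W) * f e) v)" if "v \<in> V" for v
      using f(2)[OF that] by (simp add: net_restrict[OF cutW fA])
    \<comment> \<open>All values are 0, 1 or -1, so the support consists exactly of the odd
      edges.\<close>
    fix e assume e: "e \<in> E"
    then have "\<bar>f e\<bar> \<le> 1" using f(1)[of e] by (auto simp: of_bool_def split: if_splits)
    then have "f e = 0 \<or> f e = 1 \<or> f e = -1" by arith
    then show "even (of_bool (e \<in> inside W) * f e) \<longleftrightarrow> e \<notin> A \<inter> inside W"
      using e by (auto simp: A_def)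
  qed
  moreover have "linked (A \<inter> inside W) x z" if "z \<in> W" for z
    using linked_restrict[OF _ cutW xW that] that by (auto simp: W_def)
  ultimately show ?thesis using that[of W "A \<inter> inside W"] xW by blast
qed

lemma inc_cut: "e \<in> cut S \<Longrightarrow> inc e S = 1 \<or> inc e S = -1"
  by (auto simp: inc_def cut_def)

text \<open>The net outflows over \<open>X\<close> sum to an even number, while a single boundary
  edge would contribute 1 or -1.\<close>

lemma even_edges_cut:
  assumes "even_edges B" "X \<subseteq> V"
  shows "B \<inter> cut X \<noteq> {e}"
proof
  assume eq: "B \<inter> cut X = {e}"
  have finX: "finite X" using assms finV finite_subset by blast
  have "(\<Sum>v\<in>X. net (\<lambda>e. of_bool (e \<in> B)) v) = (\<Sum>e'\<in>cut X. of_bool (e' \<in> B) * inc e' X)"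
    by (rule sum_net_cut[OF finX])
  also have "\<dots> = (\<Sum>e'\<in>{e}. of_bool (e' \<in> B) * inc e' X)"
    by (rule sum.mono_neutral_right) (use eq finite_cut in auto)
  also have "\<dots> = inc e X"
  proof -
    have "e \<in> B" using eq by blast
    then show ?thesis by simp
  qed
  finally have "(\<Sum>v\<in>X. net (\<lambda>e. of_bool (e \<in> B)) v) = inc e X" .
  moreover have "even (\<Sum>v\<in>X. net (\<lambda>e. of_bool (e \<in> B)) v)"
    by (rule dvd_sum) (use assms in \<open>auto simp: even_edges_def\<close>)
  moreover have "e \<in> cut X" using eq by blast
  ultimately show False using inc_cut[of e X] by auto
qed

lemma even_edges_Un:
  assumes "even_edges B" "even_edges C" "B \<inter> C = {}"
  shows "even_edges (B \<union> C)"
proof -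
  have eq: "of_bool (e \<in> B \<union> C) = (of_bool (e \<in> B) + of_bool (e \<in> C) :: int)" for e
    using assms(3) by auto
  show ?thesis
    using assms(1,2) unfolding even_edges_def eq net_add by auto
qed

text \<open>The net outflow from \<open>X\<close> is 0 modulo \<open>k\<close> and only
  \<open>e1\<close> and \<open>e2\<close> contribute to it, so their values agree up to sign modulo
  \<open>k\<close>.\<close>

lemma two_edge_cut:
  fixes k :: int
  assumes f: "\<And>v. v \<in> V \<Longrightarrow> k dvd net f v" and X: "X \<subseteq> V"
    and e: "e1 \<in> cut X" "e2 \<in> cut X" "e1 \<noteq> e2"
    and rest: "\<And>e. e \<in> cut X \<Longrightarrow> e \<noteq> e1 \<Longrightarrow> e \<noteq> e2 \<Longrightarrow> k dvd f e"
  shows "k dvd f e1 \<longleftrightarrow> k dvd f e2"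
proof -
  have finX: "finite X" using X finV finite_subset by blast
  have "k dvd (\<Sum>v\<in>X. net f v)" by (rule dvd_sum) (use f X in auto)
  also have "(\<Sum>v\<in>X. net f v) = f e1 * inc e1 X + (f e2 * inc e2 X + (\<Sum>e\<in>cut X - {e1} - {e2}. f e * inc e X))"
    unfolding sum_net_cut[OF finX]
    using e finite_cut sum.remove[of "cut X" e1 "\<lambda>e. f e * inc e X"]
      sum.remove[of "cut X - {e1}" e2 "\<lambda>e. f e * inc e X"] by simp
  finally have "k dvd (f e1 * inc e1 X + f e2 * inc e2 X) + (\<Sum>e\<in>cut X - {e1} - {e2}. f e * inc e X)"
    by (simp add: algebra_simps)
  moreover have "k dvd (\<Sum>e\<in>cut X - {e1} - {e2}. f e * inc e X)"
    by (rule dvd_sum) (use rest in auto)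
  ultimately have "k dvd f e1 * inc e1 X + f e2 * inc e2 X"
    using dvd_add_left_iff by blast
  moreover have "k dvd f e1 * inc e1 X \<longleftrightarrow> k dvd f e1" using inc_cut[OF e(1)] by auto
  moreover have "k dvd f e2 * inc e2 X \<longleftrightarrow> k dvd f e2" using inc_cut[OF e(2)] by auto
  ultimately show ?thesis by (metis dvd_add_left_iff dvd_add_right_iff)
qed

section \<open>Seymour's 6-flow theorem\<close>

text \<open>Each edge outside \<open>A\<close> is closed up by a unit flow through \<open>A\<close>.
  The closing flows vanish outside \<open>A\<close>, so in the sum each such edge keeps the value 1.
  This settles the end of the induction below.\<close>

lemma completing_flow:
  assumes "\<And>e. e \<in> E \<Longrightarrow> linked A (t e) (h e)"
  obtains f where "\<And>v. v \<in> V \<Longrightarrow> net f v = 0" "\<And>e. e \<in> E - A \<Longrightarrow> f e = 1"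
proof -
  have "\<forall>e\<in>E. \<exists>g. (\<forall>e'\<in>E - A. g e' = 0) \<and> (\<forall>v\<in>V. net g v = of_bool (v = t e) - of_bool (v = h e))"
    using assms unfolding linked_def by blast
  then obtain g where g: "\<And>e e'. e \<in> E \<Longrightarrow> e' \<in> E - A \<Longrightarrow> g e e' = 0"
    "\<And>e v. e \<in> E \<Longrightarrow> v \<in> V \<Longrightarrow> net (g e) v = of_bool (v = t e) - of_bool (v = h e)"
    by metis
  define f where "f e' = (\<Sum>e\<in>E - A. 1 * of_bool (e' = e) - g e e')" for e'
  show ?thesis
  proof (rule that[of f])
    fix v assume "v \<in> V"
    then show "net f v = 0"
      unfolding f_def net_sum net_diff
      by (intro sum.neutral ballI) (simp add: g(2) net_single[of _ 1, simplified])
  next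
    fix e assume e: "e \<in> E - A"
    have "f e = (\<Sum>e'\<in>E - A. of_bool (e = e'))"
      unfolding f_def by (rule sum.cong) (use g(1) e in auto)
    also have "\<dots> = 1" using e finE by (simp add: of_bool_def)
    finally show "f e = 1" .
  qed
qed

text \<open>The subgraph \<open>(U, A)\<close> grows by a connected even subgraph \<open>(W, H)\<close> inside a minimal set \<open>X\<close> outside
  \<open>U\<close> that sends at most one edge to the rest of \<open>V - U\<close>. If two edges join \<open>W\<close> to \<open>U\<close>, the flow
  obtained for the larger subgraph is made nonzero on both by a flow through \<open>A\<close> and \<open>H\<close>. If only
  one edge joins \<open>X\<close> to \<open>U\<close>, it lies in a cut of two edges and inherits its value from the other one.\<close>

lemma mod_3_flow_extending:
  assumes bridgeless: "\<And>S. S \<subseteq> V \<Longrightarrow> card (cut S) \<noteq> 1"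
    and "U \<subseteq> V" "A \<subseteq> inside U"
    and "\<And>x y. x \<in> U \<Longrightarrow> y \<in> U \<Longrightarrow> linked E x y \<Longrightarrow> linked A x y"
    and "\<And>v. v \<in> V \<Longrightarrow> \<exists>u\<in>U. linked E v u"
  shows "\<exists>B f. even_edges B \<and> B \<subseteq> inside (V - U) \<and> (\<forall>v\<in>V. 3 dvd net f v) \<and>
    (\<forall>e\<in>E - (A \<union> B). \<not> 3 dvd f e)"
  using assms(2-)
proof (induction "card (V - U)" arbitrary: U A rule: less_induct)
  case less
  note UV = less.prems(1) and AU = less.prems(2) and lnk = less.prems(3) and reach = less.prems(4)
  have AE: "A \<subseteq> E" using AU by (auto simp: inside_def)
  show ?case
  proof (cases "V - U = {}")
    case True
    then have "U = V" using UV by blast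
    have "linked A (t e) (h e)" if "e \<in> E" for e
      by (rule lnk) (use tV[OF that] hV[OF that] linked_edge[OF that that refl] \<open>U = V\<close> in auto)
    then obtain f where "\<And>v. v \<in> V \<Longrightarrow> net f v = 0" "\<And>e. e \<in> E - A \<Longrightarrow> f e = 1"
      using completing_flow by metis
    then show ?thesis
      by (intro exI[of _ "{}"] exI[of _ f]) (auto simp: even_edges_def net_def)
  next
    case False
    define P where "P X \<longleftrightarrow> X \<noteq> {} \<and> X \<subseteq> V - U \<and> card (cut X \<inter> inside (V - U)) \<le> 1" for X
    have "cut (V - U) \<inter> inside (V - U) = {}" by (auto simp: cut_def inside_def)
    then have "P (V - U)" using False by (simp add: P_def)
    then obtain X where X: "P X" and Xmin: "\<And>Y. P Y \<Longrightarrow> card X \<le> card Y"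
      using ex_has_least_nat[of P "V - U" card] by blast
    have XU: "X \<subseteq> V - U" "X \<noteq> {}" and Kle: "card (cut X \<inter> inside (V - U)) \<le> 1"
      using X by (auto simp: P_def)
    then have XV: "X \<subseteq> V" by blast
    have finX: "finite X" using XV finV finite_subset by blast
    \<comment> \<open>\<open>K\<close> holds the edges from \<open>X\<close> to the rest of
      \<open>V - U\<close>, at most one by choice of \<open>X\<close>; \<open>L\<close> holds those
      from \<open>X\<close> to \<open>U\<close>.\<close>
    define K where "K = cut X \<inter> inside (V - U)"
    define L where "L = cut X - inside (V - U)"
    have cutX: "cut X = K \<union> L" "K \<inter> L = {}" by (auto simp: K_def L_def)
    have finKL: "finite K" "finite L" using finite_cut by (auto simp: K_def L_def)
    have L_ends: "\<exists>x\<in>X. \<exists>u\<in>U. {t e, h e} = {x, u}" if "e \<in> L" for e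
    proof (cases "t e \<in> X")
      case True
      then have "h e \<in> U" using that XU tV hV by (auto simp: L_def cut_def inside_def)
      then show ?thesis using True by blast
    next
      case False
      then have "h e \<in> X" "t e \<in> U" using that XU tV hV by (auto simp: L_def cut_def inside_def)
      then show ?thesis by (metis insert_commute)
    qed
    \<comment> \<open>Without \<open>L\<close>, the boundary of \<open>X\<close> has at most one
      edge, hence none as no cut has size 1; then \<open>X\<close> could not be linked to
      \<open>U\<close>.\<close>
    have "L \<noteq> {}"
    proof
      assume "L = {}"
      then have "cut X = K" using cutX(1) by simp
      then have "card (cut X) \<le> 1" using Kle K_def by metis
      then have "card (cut X) = 0" using bridgeless[OF XV] by linarith
      then have "cut X = {}" using finite_cut by simp
      obtain z where "z \<in> X" using XU by blast
      then obtain u where "u \<in> U" "linked E z u" using reach XV by blast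
      with \<open>cut X = {}\<close> \<open>z \<in> X\<close> show False using linked_cut[OF _ XV, of E z u] XU by blast
    qed
    \<comment> \<open>The induction hypothesis for the larger subgraph: \<open>F\<close> holds new
      edges joining \<open>W\<close> to \<open>U\<close>, and its member \<open>e\<close> already
      links all of \<open>W\<close> to \<open>U\<close>. The resulting flow may vanish modulo 3 on
      \<open>H\<close> and \<open>F\<close>, which is repaired afterwards.\<close>
    have step: "\<exists>B f. even_edges B \<and> B \<subseteq> inside (V - (U \<union> W)) \<and> (\<forall>v\<in>V. 3 dvd net f v) \<and>
        (\<forall>e\<in>E - (A \<union> H \<union> F \<union> B). \<not> 3 dvd f e)"
      if W: "W \<subseteq> X" "x \<in> W" and H: "H \<subseteq> inside W" "\<And>z. z \<in> W \<Longrightarrow> linked H x z"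
        and F: "F \<subseteq> inside (U \<union> W)" "e \<in> F" "{t e, h e} = {x, u}" "u \<in> U" for W x H F e u
    proof (rule less.hyps)
      show "card (V - (U \<union> W)) < card (V - U)"
        by (rule psubset_card_mono) (use finV W XU in auto)
      show "U \<union> W \<subseteq> V" using UV W XV by blast
      show "A \<union> H \<union> F \<subseteq> inside (U \<union> W)" using AU H F by (auto simp: inside_def)
      have to_U: "\<exists>u'\<in>U. linked (A \<union> H \<union> F) x' u'" if "x' \<in> U \<union> W" for x'
      proof (cases "x' \<in> U")
        case True then show ?thesis using linked_refl by blast
      next
        case False
        then have "linked H x' x" using that H(2) linked_sym by blast
        then have "linked (A \<union> H \<union> F) x' x" by (rule linked_mono) blast
        moreover have "linked (A \<union> H \<union> F) x u"
          using F by (intro linked_edge[of e]) (auto simp: inside_def)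
        ultimately show ?thesis using linked_trans F(4) by blast
      qed
      have sub: "A \<union> H \<union> F \<subseteq> E" using AE H F by (auto simp: inside_def)
      show "linked (A \<union> H \<union> F) x' y'" if "x' \<in> U \<union> W" "y' \<in> U \<union> W" "linked E x' y'" for x' y'
      proof -
        obtain a b where ab: "a \<in> U" "linked (A \<union> H \<union> F) x' a" "b \<in> U" "linked (A \<union> H \<union> F) y' b"
          using to_U[OF \<open>x' \<in> U \<union> W\<close>] to_U[OF \<open>y' \<in> U \<union> W\<close>] by blast
        then have "linked E a x'" "linked E y' b"
          using linked_mono[OF _ sub] linked_sym by auto
        then have "linked E a b"
          using linked_trans[OF _ linked_trans[OF \<open>linked E x' y'\<close>]] by simp
        then have "linked A a b" using lnk ab by simp
        then have "linked (A \<union> H \<union> F) a b" by (rule linked_mono) blast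
        then show ?thesis using linked_trans[OF ab(2) linked_trans[OF _ linked_sym[OF ab(4)]]] by simp
      qed
      show "\<exists>u\<in>U \<union> W. linked E v u" if "v \<in> V" for v using reach[OF that] by blast
    qed
    show ?thesis
    proof (cases "card L = 1")
      case True
      then obtain e where Le: "L = {e}" using card_1_singletonE by blast
      obtain x u where xu: "x \<in> X" "u \<in> U" "{t e, h e} = {x, u}" using L_ends Le by blast
      have "card (cut X) = card K + card L"
        using cutX finKL by (simp add: card_Un_disjoint)
      moreover have "card K \<le> 1" using Kle K_def by metis
      ultimately have "card K = 1" using bridgeless[OF XV] True by linarith
      then obtain e' where Ke: "K = {e'}" using card_1_singletonE by blast
      have eE: "e \<in> E" and e'E: "e' \<in> E" using Le Ke by (auto simp: L_def K_def cut_def)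
      \<comment> \<open>A single vertex of \<open>X\<close> with an empty even subgraph is enough
        here; only the value on \<open>e\<close> has to be checked later.\<close>
      have "\<exists>B f. even_edges B \<and> B \<subseteq> inside (V - (U \<union> {x})) \<and> (\<forall>v\<in>V. 3 dvd net f v) \<and>
        (\<forall>e''\<in>E - (A \<union> {} \<union> {e} \<union> B). \<not> 3 dvd f e'')"
        by (rule step[of "{x}" x "{}" "{e}" e u]) (use xu eE linked_refl in \<open>auto simp: inside_def\<close>)
      then obtain B f where Bf: "even_edges B" "B \<subseteq> inside (V - (U \<union> {x}))"
        "\<And>v. v \<in> V \<Longrightarrow> 3 dvd net f v" "\<And>e''. e'' \<in> E - (A \<union> {} \<union> {e} \<union> B) \<Longrightarrow> \<not> 3 dvd f e''"
        by blast
      have BU: "B \<subseteq> inside (V - U)" using Bf(2) by (auto simp: inside_def)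
      \<comment> \<open>\<open>B\<close> avoids \<open>U\<close>, so it could meet the boundary of
        \<open>X\<close> only in \<open>e'\<close>, and an even subgraph never meets a cut in one
        edge.\<close>
      have "e' \<notin> B"
      proof
        assume "e' \<in> B"
        then have "B \<inter> cut X = {e'}" using BU Ke by (auto simp: K_def)
        then show False using even_edges_cut[OF Bf(1) XV] by blast
      qed
      moreover have "e' \<notin> A" using Ke AU by (auto simp: K_def inside_def)
      moreover have "e' \<noteq> e" using Ke Le cutX by auto
      ultimately have "\<not> 3 dvd f e'" using Bf(4) e'E by blast
      moreover have "3 dvd f e \<longleftrightarrow> 3 dvd f e'"
        by (rule two_edge_cut[OF Bf(3) XV]) (use cutX Ke Le \<open>e' \<noteq> e\<close> in auto)
      ultimately have "\<forall>e''\<in>E - (A \<union> B). \<not> 3 dvd f e''" using Bf(4) by blast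
      then show ?thesis using Bf(1,3) BU by blast
    next
      case False
      moreover have "card L \<noteq> 0" using \<open>L \<noteq> {}\<close> finKL(2) by simp
      ultimately have "card L \<ge> 2" by linarith
      then obtain e1 e2 where e12: "e1 \<in> L" "e2 \<in> L" "e1 \<noteq> e2"
        by (metis card_2_iff' obtain_subset_with_card_n subsetD)
      obtain x1 u1 where xu1: "x1 \<in> X" "u1 \<in> U" "{t e1, h e1} = {x1, u1}" using L_ends e12 by blast
      obtain x2 u2 where xu2: "x2 \<in> X" "u2 \<in> U" "{t e2, h e2} = {x2, u2}" using L_ends e12 by blast
      have eE: "e1 \<in> E" "e2 \<in> E" using e12 by (auto simp: L_def cut_def)
      \<comment> \<open>Minimality of \<open>X\<close> at work: if at most one edge inside
        \<open>X\<close> crossed \<open>Y\<close>, then both \<open>Y\<close> and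
        \<open>X - Y\<close>, being smaller than \<open>X\<close>, would need an edge of
        \<open>K\<close>. These edges differ, since an edge of \<open>K\<close> has just one end in
        \<open>X\<close>.\<close>
      have cut2: "2 \<le> card (inside X \<inter> cut Y)" if Y: "Y \<subseteq> X" "x1 \<in> Y" "x2 \<notin> Y" for Y
      proof (rule ccontr)
        assume "\<not> ?thesis"
        then have c1: "card (inside X \<inter> cut Y) \<le> 1" by simp
        have cut_diff: "inside X \<inter> cut (X - Y) = inside X \<inter> cut Y"
          using Y by (auto simp: inside_def cut_def)
        have small: "card X \<le> card Z"
          if Z: "Z \<subseteq> X" "Z \<noteq> {}" "card (inside X \<inter> cut Z) \<le> 1"
            and none: "cut Z \<inter> inside (V - U) \<subseteq> inside X" for Z
        proof (rule Xmin)
          have "cut Z \<inter> inside (V - U) \<subseteq> inside X \<inter> cut Z" using none by blast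
          then have "card (cut Z \<inter> inside (V - U)) \<le> card (inside X \<inter> cut Z)"
            by (intro card_mono) (use finite_cut in auto)
          then show "P Z" using Z XU by (auto simp: P_def)
        qed
        have "card Y < card X" "card (X - Y) < card X"
          using Y xu1(1) xu2(1) finX by (auto intro!: psubset_card_mono)
        then have "\<not> cut Y \<inter> inside (V - U) \<subseteq> inside X" "\<not> cut (X - Y) \<inter> inside (V - U) \<subseteq> inside X"
          using small[of Y] small[of "X - Y"] c1 cut_diff Y xu2(1) by auto
        then obtain a b where a: "a \<in> cut Y" "a \<in> inside (V - U)" "a \<notin> inside X"
          and b: "b \<in> cut (X - Y)" "b \<in> inside (V - U)" "b \<notin> inside X" by blast
        have "a \<in> K" "b \<in> K" "a \<noteq> b"
          using a b Y by (auto simp: K_def cut_def inside_def)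
        then have "2 \<le> card K" using finKL(1)
          by (metis card_2_iff card_mono empty_subsetI insert_subset)
        then show False using Kle by (simp add: K_def)
      qed
      obtain W H where WH: "W \<subseteq> X" "x1 \<in> W" "x2 \<in> W" "H \<subseteq> inside W" "even_edges H"
        "\<And>z. z \<in> W \<Longrightarrow> linked H x1 z"
        using connected_even_edges[OF XV xu1(1) xu2(1) cut2] by blast
      have "\<exists>B f. even_edges B \<and> B \<subseteq> inside (V - (U \<union> W)) \<and> (\<forall>v\<in>V. 3 dvd net f v) \<and>
        (\<forall>e\<in>E - (A \<union> H \<union> {e1, e2} \<union> B). \<not> 3 dvd f e)"
        by (rule step[of W x1 H "{e1, e2}" e1 u1])
          (use WH xu1 xu2 eE in \<open>auto simp: inside_def doubleton_eq_iff\<close>)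
      then obtain B f where Bf: "even_edges B" "B \<subseteq> inside (V - (U \<union> W))"
        "\<And>v. v \<in> V \<Longrightarrow> 3 dvd net f v" "\<And>e. e \<in> E - (A \<union> H \<union> {e1, e2} \<union> B) \<Longrightarrow> \<not> 3 dvd f e"
        by blast
      have HE: "H \<subseteq> E" using WH(4) by (auto simp: inside_def)
      have WV: "W \<subseteq> V" and WU: "W \<inter> U = {}" using WH(1) XU by auto
      \<comment> \<open>The detour through \<open>W\<close> shows that both ends lie in one
        component of the graph, so the hypothesis on \<open>U\<close> links them through
        \<open>A\<close>.\<close>
      have "linked E u1 u2"
      proof -
        have "linked E u1 x1" using xu1(3) eE by (intro linked_edge[of e1]) auto
        moreover have "linked E x1 x2" using WH(6)[OF WH(3)] HE linked_mono by blast
        moreover have "linked E x2 u2" using xu2(3) eE by (intro linked_edge[of e2]) auto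
        ultimately show ?thesis using linked_trans by blast
      qed
      then have "linked A u1 u2" using lnk xu1 xu2 by blast
      then have "linked (A \<union> H \<union> {e2}) u1 u2" by (rule linked_mono) blast
      moreover have "linked (A \<union> H \<union> {e2}) u2 x2"
        using xu2(3) eE by (intro linked_edge[of e2]) auto
      moreover have "linked (A \<union> H \<union> {e2}) x2 x1"
        using WH(6)[OF WH(3)] linked_sym linked_mono[of H x2 x1 "A \<union> H \<union> {e2}"] by blast
      ultimately have "linked (A \<union> H \<union> {e2}) u1 x1" using linked_trans by blast
      then have "linked (A \<union> H \<union> {e2}) (t e1) (h e1)"
        using xu1(3) linked_sym by (auto simp: doubleton_eq_iff)
      then obtain g0 where g0: "\<And>e. e \<in> E - (A \<union> H \<union> {e2}) \<Longrightarrow> g0 e = 0"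
        "\<And>v. v \<in> V \<Longrightarrow> net g0 v = of_bool (v = t e1) - of_bool (v = h e1)"
        unfolding linked_def by blast
      \<comment> \<open>A circulation through \<open>e1\<close> that returns via \<open>H\<close>,
        \<open>e2\<close> and \<open>A\<close>.\<close>
      define g where "g e = 1 * of_bool (e = e1) - g0 e" for e
      have net_g: "net g v = 0" if "v \<in> V" for v
        using g0(2)[OF that] unfolding g_def net_diff net_single[OF eE(1)] by simp
      have e12_ends: "e1 \<notin> A" "e2 \<notin> A" "e1 \<notin> H" "e2 \<notin> H" "e1 \<in> cut W" "e2 \<in> cut W"
        using xu1 xu2 WH AU WU XU eE by (auto simp: inside_def cut_def doubleton_eq_iff)
      have "g e1 = 1" using g0(1)[of e1] e12_ends e12(3) eE by (simp add: g_def)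
      have g_supp: "g e = 0" if "e \<in> E - (A \<union> H \<union> {e1, e2})" for e
        using that g0(1)[of e] by (simp add: g_def)
      \<comment> \<open>Across the boundary of \<open>W\<close> only \<open>e1\<close> and
        \<open>e2\<close> can carry \<open>g\<close>, so \<open>g\<close> is nonzero modulo 3 on
        both.\<close>
      have "3 dvd g e1 \<longleftrightarrow> 3 dvd g e2"
      proof (rule two_edge_cut[of 3 g W])
        fix e assume e: "e \<in> cut W" "e \<noteq> e1" "e \<noteq> e2"
        then have "e \<notin> A" "e \<notin> H" "e \<in> E" using AU WH(4) WU by (auto simp: inside_def cut_def)
        then show "3 dvd g e" using g_supp[of e] e by simp
      qed (use net_g WV e12_ends e12 in auto)
      then have "\<not> 3 dvd g e1" "\<not> 3 dvd g e2" using \<open>g e1 = 1\<close> by auto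
      then obtain c where c: "\<not> 3 dvd f e1 + c * g e1" "\<not> 3 dvd f e2 + c * g e2"
        using avoid_zero_mod_3[of "g e1" "g e2" "f e1" "f e2"] by blast
      \<comment> \<open>Besides \<open>e1\<close> and \<open>e2\<close>, the change affects only
        \<open>A\<close>, where zeros are allowed, and \<open>H\<close>, which joins the even
        part.\<close>
      define f' where "f' e = f e + c * g e" for e
      have "3 dvd net f' v" if "v \<in> V" for v
        using Bf(3)[OF that] unfolding f'_def net_add net_cmult net_g[OF that] by simp
      moreover have "\<not> 3 dvd f' e" if "e \<in> E - (A \<union> (H \<union> B))" for e
      proof (cases "e \<in> {e1, e2}")
        case True then show ?thesis using c by (auto simp: f'_def)
      next
        case False
        then show ?thesis using that Bf(4)[of e] g_supp[of e] by (auto simp: f'_def)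
      qed
      moreover have "H \<inter> B = {}" using WH(4) Bf(2) by (auto simp: inside_def)
      then have "even_edges (H \<union> B)" using even_edges_Un WH(5) Bf(1) by blast
      moreover have "H \<union> B \<subseteq> inside (V - U)"
        using WH(1,4) Bf(2) XU by (auto simp: inside_def)
      ultimately show ?thesis by blast
    qed
  qed
qed

theorem Seymour_six_flow:
  assumes bridgeless: "\<And>S. S \<subseteq> V \<Longrightarrow> card (cut S) \<noteq> 1"
  obtains B f where "even_edges B" "\<And>v. v \<in> V \<Longrightarrow> 3 dvd net f v" "\<And>e. e \<in> E - B \<Longrightarrow> \<not> 3 dvd f e"
proof -
  \<comment> \<open>The growth starts from one representative per component with no edges: distinct
    representatives are never linked, so the empty edge set suffices.\<close>
  define r where "r v = (SOME u. u \<in> V \<and> linked E v u)" for v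
  have r: "r v \<in> V \<and> linked E v (r v)" if "v \<in> V" for v
  proof -
    have "\<exists>u. u \<in> V \<and> linked E v u" using that linked_refl by blast
    then show ?thesis unfolding r_def by (rule someI_ex)
  qed
  have r_eq: "r v = r v'" if "linked E v v'" for v v'
  proof -
    have "linked E v u \<longleftrightarrow> linked E v' u" for u
      using linked_trans[OF that] linked_trans[OF linked_sym[OF that]] by blast
    then show ?thesis by (simp add: r_def)
  qed
  have "\<exists>B f. even_edges B \<and> B \<subseteq> inside (V - r ` V) \<and> (\<forall>v\<in>V. 3 dvd net f v) \<and>
    (\<forall>e\<in>E - ({} \<union> B). \<not> 3 dvd f e)"
  proof (rule mod_3_flow_extending[OF bridgeless])
    fix x y assume "x \<in> r ` V" "y \<in> r ` V" and xy: "linked E x y"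
    then obtain a b where ab: "a \<in> V" "b \<in> V" "x = r a" "y = r b" by blast
    then have "linked E a b"
      using linked_trans[OF _ linked_trans[OF xy linked_sym]] r[of a] r[of b] by simp
    then show "linked {} x y" using r_eq ab linked_refl by simp
  qed (use r in auto)
  then obtain B f where "even_edges B" "\<forall>v\<in>V. 3 dvd net f v" "\<forall>e\<in>E - B. \<not> 3 dvd f e"
    unfolding Un_empty_left by blast
  then show ?thesis using that[of B f] by simp
qed

text \<open>\<open>c\<close> lifts the even subgraph and \<open>g\<close> the flow modulo 3. A lift
  \<open>d\<close> of \<open>g\<close> modulo 2 has the parity of \<open>g\<close>, so
  \<open>a\<close> and \<open>b\<close> with \<open>a + b = g\<close> and \<open>a - b = d\<close>
  are integral.\<close>

corollary integral_six_flow: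
  assumes bridgeless: "\<And>S. S \<subseteq> V \<Longrightarrow> card (cut S) \<noteq> 1"
  obtains a b c where "\<And>v. v \<in> V \<Longrightarrow> net a v = 0 \<and> net b v = 0 \<and> net c v = 0"
    "\<And>e. e \<in> E \<Longrightarrow> \<exists>s\<in>{1, -1}. (a e, b e) \<in> {(0, 0), (s, 0), (0, s), (s, s)}"
    "\<And>e. e \<in> E \<Longrightarrow> \<bar>c e\<bar> \<le> 1 \<and> (a e \<noteq> 0 \<or> b e \<noteq> 0 \<or> c e \<noteq> 0)"
proof -
  obtain B f where Bf: "even_edges B" "\<And>v. v \<in> V \<Longrightarrow> 3 dvd net f v" "\<And>e. e \<in> E - B \<Longrightarrow> \<not> 3 dvd f e"
    using Seymour_six_flow[OF bridgeless] by metis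
  obtain c where c: "\<And>e. e \<in> E \<Longrightarrow> \<bar>c e\<bar> < 2 \<and> 2 dvd c e - of_bool (e \<in> B)" "\<And>v. v \<in> V \<Longrightarrow> net c v = 0"
    using modular_lift[of 2 "\<lambda>e. of_bool (e \<in> B)"] Bf(1) unfolding even_edges_def by (metis zero_less_numeral)
  obtain g where g: "\<And>e. e \<in> E \<Longrightarrow> \<bar>g e\<bar> < 3 \<and> 3 dvd g e - f e" "\<And>v. v \<in> V \<Longrightarrow> net g v = 0"
    using modular_lift[of 3 f] Bf(2) by (metis zero_less_numeral)
  obtain d where d: "\<And>e. e \<in> E \<Longrightarrow> \<bar>d e\<bar> < 2 \<and> 2 dvd d e - g e" "\<And>v. v \<in> V \<Longrightarrow> net d v = 0"
    using modular_lift[of 2 g] g(2) by (metis zero_less_numeral dvd_0_right)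
  define a where "a e = (g e + d e) div 2" for e
  define b where "b e = (g e - d e) div 2" for e
  have ab: "2 * a e = g e + d e" "2 * b e = g e - d e" if "e \<in> E" for e
    using d(1)[OF that] unfolding a_def b_def by presburger+
  have "net (\<lambda>e. 2 * a e) v = 0" "net (\<lambda>e. 2 * b e) v = 0" if "v \<in> V" for v
    using ab g(2)[OF that] d(2)[OF that]
      net_cong[of "\<lambda>e. 2 * a e" "\<lambda>e. g e + d e"] net_cong[of "\<lambda>e. 2 * b e" "\<lambda>e. g e - d e"]
    by (simp_all add: net_add net_diff)
  then have net_ab: "net a v = 0" "net b v = 0" if "v \<in> V" for v
    using that by (simp_all add: net_cmult)
  show ?thesis
  proof (rule that[of a b c])
    fix e assume e: "e \<in> E"
    have gd: "-2 \<le> g e" "g e \<le> 2" "-1 \<le> d e" "d e \<le> 1"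
      using g(1)[OF e] d(1)[OF e] by auto
    \<comment> \<open>This rules out that \<open>a e\<close> and \<open>b e\<close> are nonzero of
      opposite signs.\<close>
    have bound: "\<bar>a e - b e\<bar> \<le> 1"
      using ab[OF e] d(1)[OF e] by auto
    have "-1 \<le> a e" "a e \<le> 1" "-1 \<le> b e" "b e \<le> 1"
      using gd ab[OF e] by linarith+
    then have "a e \<in> {-1, 0, 1}" "b e \<in> {-1, 0, 1}" by auto
    then show "\<exists>s\<in>{1, -1}. (a e, b e) \<in> {(0, 0), (s, 0), (0, s), (s, s)}"
      using bound by (elim insertE emptyE) auto
    have "g e \<noteq> 0 \<or> c e \<noteq> 0"
      using Bf(3)[of e] g(1)[OF e] c(1)[OF e] e by (cases "e \<in> B") (auto simp: dvd_diff_commute)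
    then show "\<bar>c e\<bar> \<le> 1 \<and> (a e \<noteq> 0 \<or> b e \<noteq> 0 \<or> c e \<noteq> 0)"
      using c(1)[OF e] ab[OF e] by auto
  qed (use net_ab c(2) in auto)
qed

end

section \<open>Vector flows\<close>

text \<open>A lone edge across \<open>S\<close> would be a bridge: deleting it separates its ends,
  so the map from the components after deletion to those of \<open>G\<close> is onto but not
  injective.\<close>

lemma bridgeless_imp_cut:
  assumes G: "loopless_multigraph G" and bl: "bridgeless G"
    and ends: "\<And>e. e \<in> edges G \<Longrightarrow> {t e, h e} = ends G e"
    and S: "S \<subseteq> vertices G"
  shows "card {e \<in> edges G. (t e \<in> S) \<noteq> (h e \<in> S)} \<noteq> 1"
proof
  interpret loopless_multigraph G by fact
  assume "card {e \<in> edges G. (t e \<in> S) \<noteq> (h e \<in> S)} = 1"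
  then obtain e where cut: "{e \<in> edges G. (t e \<in> S) \<noteq> (h e \<in> S)} = {e}"
    using card_1_singletonE by blast
  then have e: "e \<in> edges G" "(t e \<in> S) \<noteq> (h e \<in> S)" by blast+
  then have e_verts: "t e \<in> vertices G" "h e \<in> vertices G"
    using ends[of e] ends_subset[of e] by auto
  define G' where "G' = delete_edge G e"
  have verts': "vertices G' = vertices G" by (simp add: G'_def delete_edge_def)
  have adj': "adjacency G' \<subseteq> adjacency G"
    by (auto simp: G'_def delete_edge_def adjacency_def)
  have side: "u \<in> S \<longleftrightarrow> v \<in> S" if "(u, v) \<in> adjacency G'" for u v
  proof -
    from that obtain e' where e': "e' \<in> edges G" "e' \<noteq> e" "ends G e' = {u, v}"
      by (auto simp: G'_def delete_edge_def adjacency_def)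
    then have "(t e' \<in> S) = (h e' \<in> S)" using cut by blast
    then show ?thesis using ends[OF e'(1)] e'(3) by (auto simp: doubleton_eq_iff)
  qed
  have "u \<in> S \<longleftrightarrow> v \<in> S" if "(u, v) \<in> (adjacency G')\<^sup>*" for u v
    using that by (induction rule: rtrancl_induct) (auto dest: side)
  then have separated: "(t e, h e) \<notin> connection G'"
    using e(2) by (auto simp: connection_def)
  have "sym ((adjacency G)\<^sup>*)"
    by (intro sym_rtrancl) (auto simp: sym_def adjacency_def insert_commute)
  then have sym: "(v, u) \<in> connection G" if "(u, v) \<in> connection G" for u v
    using that by (auto simp: connection_def sym_def)
  have trans: "(u, w) \<in> connection G" if "(u, v) \<in> connection G" "(v, w) \<in> connection G" for u v w
    using that by (auto simp: connection_def)
  have refl': "(v, v) \<in> connection G'" if "v \<in> vertices G" for v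
    using that by (simp add: connection_def verts')
  have sub: "connection G' \<subseteq> connection G"
    using rtrancl_mono[OF adj'] by (auto simp: connection_def verts')
  have joined: "(t e, h e) \<in> connection G"
    using e e_verts ends[OF e(1)] by (auto simp: connection_def adjacency_def intro!: r_into_rtrancl)
  have comps: "graph_components H = (\<lambda>v. connection H `` {v}) ` vertices H" for H :: "('a, 'b) mgraph"
    by (auto simp: graph_components_def quotient_def)
  have merge: "connection G `` (connection G' `` {v}) = connection G `` {v}" if "v \<in> vertices G" for v
    using refl'[OF that] sub trans by blast
  have fin: "finite (graph_components G')"
    by (simp add: comps verts' finite_vertices)
  have image: "graph_components G = (\<lambda>K. connection G `` K) ` graph_components G'"
    unfolding comps verts' image_image using merge by (intro image_cong) auto
  have "\<not> inj_on (\<lambda>K. connection G `` K) (graph_components G')"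
  proof
    assume inj: "inj_on (\<lambda>K. connection G `` K) (graph_components G')"
    have "connection G `` {t e} = connection G `` {h e}"
      using joined sym trans by blast
    then have "connection G `` (connection G' `` {t e}) = connection G `` (connection G' `` {h e})"
      using merge e_verts by simp
    then have "connection G' `` {t e} = connection G' `` {h e}"
      by (rule inj_onD[OF inj]) (use e_verts in \<open>simp_all add: comps verts'\<close>)
    then show False using separated refl'[OF e_verts(2)] by blast
  qed
  then have "card (graph_components G) \<noteq> card (graph_components G')"
    using image eq_card_imp_inj_on[OF fin] by metis
  moreover have "card (graph_components G) \<le> card (graph_components G')"
    unfolding image by (rule card_image_le[OF fin])
  ultimately have "bridge G e" using e(1) by (simp add: bridge_def G'_def)
  then show False using bl by (simp add: bridgeless_def)
qed

lemma p_norm_uminus: "p_norm p (- x) = p_norm p x"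
  by (simp add: p_norm_def infnorm_neg)

text \<open>The ten vectors are, up to sign, all values of the combined flow. No difference of
  \<open>u\<close> and \<open>w\<close> is among them, because \<open>a\<close> and \<open>b\<close>
  never have opposite signs.\<close>

lemma flow_index_le:
  fixes G :: "('v, 'e) mgraph" and u w z :: "real ^ 'd::finite" and g p :: real
  assumes G: "loopless_multigraph G" "bridgeless G" and "1 \<le> p" "1 \<le> g"
    and norms: "\<And>x. x \<in> {u, w, u + w, z, z + u, z - u, z + w, z - w, z + (u + w), z - (u + w)} \<Longrightarrow>
      1 \<le> p_norm (ereal p) x \<and> p_norm (ereal p) x \<le> g"
  shows "flow_index TYPE('d) (ereal p) G \<le> ereal (1 + g)"
proof -
  interpret loopless_multigraph G by fact
  \<comment> \<open>Any orientation will do, since the flows may take negative values.\<close>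
  have "\<forall>e\<in>edges G. \<exists>x y. {x, y} = ends G e \<and> x \<noteq> y"
    using card_ends unfolding card_2_iff by metis
  then obtain t h where th: "\<And>e. e \<in> edges G \<Longrightarrow> {t e, h e} = ends G e \<and> t e \<noteq> h e"
    by metis
  interpret oriented_graph "vertices G" "edges G" t h
  proof
    show "t e \<in> vertices G" "h e \<in> vertices G" if "e \<in> edges G" for e
      using th[OF that] ends_subset[OF that] by auto
  qed (use th finite_vertices finite_edges in auto)
  have "card (cut S) \<noteq> 1" if "S \<subseteq> vertices G" for S
    unfolding cut_def using bridgeless_imp_cut[OF G _ that] th by blast
  then obtain a b c where flows: "\<And>v. v \<in> vertices G \<Longrightarrow> net a v = 0 \<and> net b v = 0 \<and> net c v = 0"
    and ab: "\<And>e. e \<in> edges G \<Longrightarrow> \<exists>s\<in>{1, -1}. (a e, b e) \<in> {(0, 0), (s, 0), (0, s), (s, s)}"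
    and c: "\<And>e. e \<in> edges G \<Longrightarrow> \<bar>c e\<bar> \<le> 1 \<and> (a e \<noteq> 0 \<or> b e \<noteq> 0 \<or> c e \<noteq> 0)"
    using integral_six_flow by metis
  define f where "f e = of_int (a e) *\<^sub>R u + of_int (b e) *\<^sub>R w + of_int (c e) *\<^sub>R z" for e
  have f_norm: "1 \<le> p_norm (ereal p) (f e) \<and> p_norm (ereal p) (f e) \<le> g" if e: "e \<in> edges G" for e
  proof -
    let ?N = "{u, w, u + w, z, z + u, z - u, z + w, z - w, z + (u + w), z - (u + w)}"
    define y where "y = real_of_int (a e) *\<^sub>R u + real_of_int (b e) *\<^sub>R w"
    have fy: "f e = y + real_of_int (c e) *\<^sub>R z" by (simp add: f_def y_def)
    have cv: "c e = -1 \<or> c e = 0 \<or> c e = 1" using c[OF e] by arith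
    obtain s where "s = 1 \<or> s = -1" "(a e, b e) \<in> {(0, 0), (s, 0), (0, s), (s, s)}"
      using ab[OF e] by auto
    then have "(y = 0 \<and> a e = 0 \<and> b e = 0) \<or> (\<exists>x\<in>{u, w, u + w}. y = x \<or> y = - x)"
      by (auto simp: y_def)
    then have "f e \<in> ?N \<or> - f e \<in> ?N"
    proof (elim disjE conjE bexE)
      assume "y = 0" "a e = 0" "b e = 0"
      then have "f e = z \<or> - f e = z" using cv c[OF e] fy by auto
      then show ?thesis by auto
    next
      fix x assume x: "x \<in> {u, w, u + w}" and "y = x"
      then have "f e = x \<or> f e = z + x \<or> - f e = z - x" using cv fy by auto
      then show ?thesis using x by auto
    next
      fix x assume x: "x \<in> {u, w, u + w}" and "y = - x"
      then have "- f e = x \<or> f e = z - x \<or> - f e = z + x" using cv fy by auto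
      then show ?thesis using x by auto
    qed
    then show ?thesis using norms p_norm_uminus by metis
  qed
  have nz: "f e \<noteq> 0" if "e \<in> edges G" for e
  proof
    assume "f e = 0"
    then show False using f_norm[OF that] \<open>1 \<le> p\<close> by (simp add: p_norm_def)
  qed
  define D where "D = \<lparr>verts = vertices G, arcs = edges G, tail = t, head = h\<rparr>"
  have conserve: "(\<Sum>e\<in>out_arcs D v. f e) - (\<Sum>e\<in>in_arcs D v. f e) = 0" if v: "v \<in> vertices G" for v
  proof -
    have "(\<Sum>e\<in>out_arcs D v. f e) - (\<Sum>e\<in>in_arcs D v. f e) = (\<Sum>e\<in>edges G. of_int (inc e {v}) *\<^sub>R f e)"
    proof -
      have "(\<Sum>e\<in>out_arcs D v. f e) = (\<Sum>e\<in>edges G. if t e = v then f e else 0)"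
        unfolding sum.inter_filter[OF finite_edges, symmetric] by (simp add: out_arcs_def D_def)
      moreover have "(\<Sum>e\<in>in_arcs D v. f e) = (\<Sum>e\<in>edges G. if h e = v then f e else 0)"
        unfolding sum.inter_filter[OF finite_edges, symmetric] by (simp add: in_arcs_def D_def)
      ultimately show ?thesis
        by (simp add: sum_subtractf[symmetric]) (rule sum.cong, auto simp: inc_def)
    qed
    also have "\<dots> = of_int (net a v) *\<^sub>R u + of_int (net b v) *\<^sub>R w + of_int (net c v) *\<^sub>R z"
      unfolding net_def f_def
      by (simp add: scaleR_sum_left sum.distrib[symmetric] algebra_simps)
    also have "\<dots> = 0" using flows[OF v] by simp
    finally show ?thesis .
  qed
  have "orientation G D" using th by (simp add: orientation_def D_def)
  then have "is_NZF (1 + g) (ereal p) G D f"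
    using nz f_norm conserve \<open>1 \<le> p\<close> \<open>1 \<le> g\<close> by (simp add: is_NZF_def vector_flow_def)
  then show ?thesis
    unfolding flow_index_def by (intro Inf_lower) blast
qed

section \<open>Inequalities for powers and norms in dimension three\<close>

lemma powr_superadditive:
  fixes b c p :: real
  assumes "0 \<le> b" "0 \<le> c" "1 \<le> p"
  shows "b powr p + c powr p \<le> (b + c) powr p"
proof -
  have split: "x powr p = x * x powr (p - 1)" if "0 \<le> x" for x :: real
    using that powr_mult_base[of x "p - 1"] by simp
  have "b * b powr (p - 1) + c * c powr (p - 1) \<le> b * (b + c) powr (p - 1) + c * (b + c) powr (p - 1)"
    using assms by (intro add_mono mult_left_mono powr_mono2) auto
  then show ?thesis using assms by (simp add: split distrib_right)
qed

text \<open>Convexity: the pairs \<open>b, a + c\<close> and \<open>b + c, a\<close> have the same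
  sum, and the first lies between the members of the second.\<close>

lemma powr_add_le:
  fixes a b c p :: real
  assumes "0 < a" "a \<le> b" "0 \<le> c" "1 \<le> p"
  shows "b powr p + (a + c) powr p \<le> (b + c) powr p + a powr p"
proof (cases "b + c = a")
  case False
  \<comment> \<open>With this weight, \<open>b\<close> and \<open>a + c\<close> are the two mirrored
    convex combinations of \<open>b + c\<close> and \<open>a\<close>.\<close>
  define l where "l = c / (b + c - a)"
  have pos: "b + c - a > 0" using assms False by simp
  have l: "0 \<le> l" "l \<le> 1" using assms pos by (auto simp: l_def field_simps)
  have lc: "l * (b + c - a) = c" using pos by (simp add: l_def)
  have conv: "convex_on {0<..} (\<lambda>x::real. x powr p)" by (rule powr_convex) fact
  have mix: "(1 - l) *\<^sub>R (b + c) + l *\<^sub>R a = b" "(1 - l) *\<^sub>R a + l *\<^sub>R (b + c) = a + c"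
    using lc by (auto simp: algebra_simps)
  have "((1 - l) *\<^sub>R (b + c) + l *\<^sub>R a) powr p \<le> (1 - l) * (b + c) powr p + l * a powr p"
    by (rule convex_onD[OF conv]) (use l assms in auto)
  moreover have "((1 - l) *\<^sub>R a + l *\<^sub>R (b + c)) powr p \<le> (1 - l) * a powr p + l * (b + c) powr p"
    by (rule convex_onD[OF conv]) (use l assms in auto)
  ultimately show ?thesis unfolding mix by (simp add: algebra_simps)
qed (use assms in auto)

lemma powr_neg_inverse_powr:
  fixes x p :: real
  assumes "0 < x" "1 \<le> p"
  shows "(x powr (- 1 / p)) powr p = 1 / x"
proof -
  have "(x powr (- 1 / p)) powr p = x powr (- 1 / p * p)" by (simp only: powr_powr)
  also have "- 1 / p * p = - 1" using assms by simp
  finally show ?thesis using assms by (simp add: powr_minus_divide)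
qed

lemma p_norm_vector_3:
  fixes p g x y z :: real
  assumes "1 \<le> p" "0 \<le> g" "1 \<le> \<bar>x\<bar> powr p + \<bar>y\<bar> powr p + \<bar>z\<bar> powr p"
    "\<bar>x\<bar> powr p + \<bar>y\<bar> powr p + \<bar>z\<bar> powr p \<le> g powr p"
  shows "1 \<le> p_norm (ereal p) (vector [x, y, z] :: real ^ 3) \<and>
    p_norm (ereal p) (vector [x, y, z] :: real ^ 3) \<le> g"
proof -
  let ?s = "\<bar>x\<bar> powr p + \<bar>y\<bar> powr p + \<bar>z\<bar> powr p"
  have "p_norm (ereal p) (vector [x, y, z] :: real ^ 3) = ?s powr (1 / p)"
    by (simp add: p_norm_def sum_3)
  moreover have "1 \<le> ?s powr (1 / p)" using assms by (intro ge_one_powr_ge_zero) auto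
  moreover have "?s powr (1 / p) \<le> (g powr p) powr (1 / p)"
    using assms by (intro powr_mono2) auto
  moreover have "(g powr p) powr (1 / p) = g" using assms by (simp add: powr_powr)
  ultimately show ?thesis by simp
qed

lemma vector_3_add: "vector [a, b, c] + vector [a', b', c'] = (vector [a + a', b + b', c + c'] :: real ^ 3)"
  by (simp add: vec_eq_iff forall_3)

lemma vector_3_diff: "vector [a, b, c] - vector [a', b', c'] = (vector [a - a', b - b', c - c'] :: real ^ 3)"
  by (simp add: vec_eq_iff forall_3)

section \<open>The two choices of vectors\<close>

lemma flow_index_le_g1:
  assumes "loopless_multigraph G" "bridgeless G" "1 \<le> p"
  shows "flow_index TYPE(3) (ereal p) G \<le> ereal (1 + g1 p)"
proof -
  \<comment> \<open>\<open>N\<close> is the sum of \<open>p\<close>-th powers for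
    \<open>(3, 3, 2)\<close>, so scaling by \<open>L\<close> gives \<open>z\<close> norm 1.\<close>
  define N where "N = 2 * 3 powr p + 2 powr p"
  define L where "L = N powr (- 1 / p)"
  have N: "N > 0" by (simp add: N_def add_pos_pos)
  have L: "L > 0" using N by (simp add: L_def)
  have Lp: "L powr p = 1 / N" unfolding L_def by (rule powr_neg_inverse_powr) fact+
  have g1_ge: "1 \<le> g1 p"
    using \<open>1 \<le> p\<close> ge_one_powr_ge_zero[of 2 "1 - 1 / p"] by (simp add: g1_def)
  have g1_powr: "g1 p powr p = (5 / 2) powr p / 2"
  proof -
    have "g1 p powr p = (5 / 4) powr p * 2 powr ((1 - 1 / p) * p)"
      unfolding g1_def powr_powr[symmetric] by (rule powr_mult)
    also have "(1 - 1 / p) * p = p - 1" using \<open>1 \<le> p\<close> by (simp add: field_simps)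
    also have "(5 / 4) powr p * 2 powr (p - 1) = ((5 / 4) powr p * 2 powr p) / 2"
      by (simp add: powr_diff)
    also have "(5 / 4) powr p * 2 powr p = (5 / 2) powr p"
      by (simp add: powr_mult[symmetric])
    finally show ?thesis .
  qed
  note add_le = powr_add_le[OF _ _ _ \<open>1 \<le> p\<close>] and super = powr_superadditive[OF _ _ \<open>1 \<le> p\<close>]
  \<comment> \<open>\<open>small\<close> serves the lower bounds and \<open>big\<close> the upper
    bounds. All these inequalities are equalities at \<open>p = 1\<close>, and the norm estimates
    follow from them linearly.\<close>
  have small: "4 powr p + 1 \<ge> 3 powr p + 2 powr p" "4 powr p \<ge> 3 powr p + 1"
    "6 powr p \<ge> 3 powr p + 3 powr p" "6 powr p \<ge> 4 powr p + 2 powr p" "7 powr p \<ge> 6 powr p + 1"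
    "2 powr p \<ge> 1 + (1::real)" "3 powr p \<ge> 2 powr p + (1::real)"
    using add_le[of 1 3 1] super[of 3 1] super[of 3 3] super[of 4 2] super[of 6 1] super[of 1 1] super[of 2 1] by simp_all
  have big: "15 powr p \<ge> 14 powr p + 1" "15 powr p + 1 \<ge> 14 powr p + 2 powr p"
    "10 powr p \<ge> 6 powr p + 4 powr p" "15 powr p \<ge> 12 powr p + 3 powr p"
    "15 powr p + 3 powr p \<ge> 12 powr p + 6 powr p" "10 powr p + 6 powr p \<ge> 8 powr p + 8 powr p"
    "8 powr p \<ge> 4 powr p + (4::real) powr p" "8 powr p \<ge> 6 powr p + (2::real) powr p"
    "12 powr p \<ge> 8 powr p + (4::real) powr p"
    using super[of 14 1] add_le[of 1 14 1] super[of 6 4] super[of 12 3] add_le[of 3 12 3]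
      add_le[of 6 8 2] super[of 4 4] super[of 6 2] super[of 8 4] by simp_all
  \<comment> \<open>Doubling the entries clears the denominators of \<open>g1 p powr p\<close>: the
    right-hand side of \<open>upper\<close> is \<open>5 powr p * N\<close>.\<close>
  have norm_ok: "1 \<le> p_norm (ereal p) (vector [x * L, y * L, z * L] :: real ^ 3) \<and>
      p_norm (ereal p) (vector [x * L, y * L, z * L] :: real ^ 3) \<le> g1 p"
    if lower: "N \<le> \<bar>x\<bar> powr p + \<bar>y\<bar> powr p + \<bar>z\<bar> powr p"
      and upper: "2 * (\<bar>2 * x\<bar> powr p + \<bar>2 * y\<bar> powr p + \<bar>2 * z\<bar> powr p) \<le> 2 * 15 powr p + 10 powr p"
    for x y z
  proof (rule p_norm_vector_3)
    have eq: "\<bar>x * L\<bar> powr p + \<bar>y * L\<bar> powr p + \<bar>z * L\<bar> powr p =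
      (\<bar>x\<bar> powr p + \<bar>y\<bar> powr p + \<bar>z\<bar> powr p) / N"
      using L by (simp add: abs_mult powr_mult Lp add_divide_distrib)
    show "1 \<le> \<bar>x * L\<bar> powr p + \<bar>y * L\<bar> powr p + \<bar>z * L\<bar> powr p"
      unfolding eq using lower N by simp
    have "2 * 2 powr p * (\<bar>x\<bar> powr p + \<bar>y\<bar> powr p + \<bar>z\<bar> powr p) \<le> 2 * 15 powr p + 10 powr p"
      using upper by (simp add: abs_mult powr_mult algebra_simps)
    also have "2 * 15 powr p + 10 powr p = 5 powr p * N"
      using powr_mult[of 5 3 p] powr_mult[of 5 2 p] by (simp add: N_def algebra_simps)
    finally have "\<bar>x\<bar> powr p + \<bar>y\<bar> powr p + \<bar>z\<bar> powr p \<le> (5 powr p / 2 powr p) / 2 * N"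
      by (simp add: field_simps)
    then show "\<bar>x * L\<bar> powr p + \<bar>y * L\<bar> powr p + \<bar>z * L\<bar> powr p \<le> g1 p powr p"
      unfolding eq g1_powr using N by (simp add: powr_divide field_simps)
  qed (use g1_ge \<open>1 \<le> p\<close> in auto)
  \<comment> \<open>Every entry is a multiple of \<open>L\<close>, even \<open>1 * L\<close> and
    \<open>0 * L\<close>, so that \<open>L\<close> factors out of all ten vectors and
    \<open>norm_ok\<close> matches.\<close>
  let ?u = "vector [1 * L, - 3 * L, 4 * L] :: real ^ 3"
  let ?w = "vector [- 4 * L, 4 * L, 0 * L] :: real ^ 3"
  let ?z = "vector [3 * L, 3 * L, 2 * L] :: real ^ 3"
  show ?thesis
  proof (rule flow_index_le[OF assms g1_ge, of ?u ?w ?z])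
    fix x
    assume "x \<in> {?u, ?w, ?u + ?w, ?z, ?z + ?u, ?z - ?u, ?z + ?w, ?z - ?w, ?z + (?u + ?w), ?z - (?u + ?w)}"
    then show "1 \<le> p_norm (ereal p) x \<and> p_norm (ereal p) x \<le> g1 p"
      unfolding vector_3_add vector_3_diff distrib_right[symmetric] left_diff_distrib[symmetric]
      by (elim insertE emptyE; hypsubst; intro norm_ok) (use small big in \<open>simp_all add: N_def\<close>)
  qed
qed

text \<open>As \<open>a powr p = 1 / 2\<close> and \<open>b powr p = 1 / 3\<close>, the vectors
  \<open>u\<close>, \<open>w\<close>, \<open>u + w\<close> and \<open>z\<close> have norm 1. The
  other six have entries \<open>a + b\<close>, \<open>a - b\<close>, \<open>b\<close> up to order
  and sign, so their norm is exactly \<open>g2 p\<close>.\<close>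

lemma flow_index_le_g2:
  assumes "loopless_multigraph G" "bridgeless G" "1 \<le> p"
  shows "flow_index TYPE(3) (ereal p) G \<le> ereal (1 + g2 p)"
proof -
  define a b :: real where "a = 2 powr (- 1 / p)" and "b = 3 powr (- 1 / p)"
  have ap: "a powr p = 1 / 2" and bp: "b powr p = 1 / 3"
    unfolding a_def b_def by (rule powr_neg_inverse_powr; use \<open>1 \<le> p\<close> in simp)+
  have b: "0 < b" by (simp add: b_def)
  have ba: "b < a" unfolding a_def b_def using \<open>1 \<le> p\<close> by (intro powr_less_mono2_neg) auto
  have g2_powr: "g2 p powr p = (a + b) powr p + (a - b) powr p + 1 / 3"
    using \<open>1 \<le> p\<close> by (simp add: g2_def a_def b_def powr_powr add_nonneg_nonneg)
  \<comment> \<open>This gives \<open>5 / 6\<close> for the first summand; together with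
    \<open>1 / 3\<close> the sum exceeds 1.\<close>
  have s: "a powr p + b powr p \<le> (a + b) powr p"
    using powr_superadditive[of a b p] ba b \<open>1 \<le> p\<close> by simp
  then have one: "1 \<le> (a + b) powr p + (a - b) powr p + 1 / 3"
    using powr_ge_zero[of "a - b" p] unfolding ap bp by linarith
  have g2_ge: "1 \<le> g2 p"
    using ge_one_powr_ge_zero[OF one, of "1 / p"] \<open>1 \<le> p\<close> by (simp add: g2_def a_def b_def)
  let ?u = "vector [a, - a, 0] :: real ^ 3"
  let ?w = "vector [0, a, - a] :: real ^ 3"
  let ?z = "vector [b, b, b] :: real ^ 3"
  have absv: "\<bar>a\<bar> = a" "\<bar>b\<bar> = b" "\<bar>b + a\<bar> = a + b" "\<bar>b - a\<bar> = a - b" using b ba by auto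
  show ?thesis
  proof (rule flow_index_le[OF assms g2_ge, of ?u ?w ?z])
    fix x
    assume "x \<in> {?u, ?w, ?u + ?w, ?z, ?z + ?u, ?z - ?u, ?z + ?w, ?z - ?w, ?z + (?u + ?w), ?z - (?u + ?w)}"
    then show "1 \<le> p_norm (ereal p) x \<and> p_norm (ereal p) x \<le> g2 p"
      unfolding vector_3_add vector_3_diff
      by (elim insertE emptyE; hypsubst; intro p_norm_vector_3)
        (use one g2_ge \<open>1 \<le> p\<close> in \<open>simp_all add: g2_powr absv ap bp\<close>)
  qed
qed

theorem theorem3p1:
  fixes G :: "('v, 'e) mgraph" and p :: real
  assumes "loopless_multigraph G" and "bridgeless G"
    and "1 \<le> p" and "p \<le> 2"
  shows "flow_index TYPE(3) (ereal p) G \<le> ereal (1 + min (g1 p) (g2 p))"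
  using flow_index_le_g1[OF assms(1-3)] flow_index_le_g2[OF assms(1-3)] by (simp add: min_def)

end
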